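(* Let $\mathbb{K}$ be a field of characteristic zero. (i) If $Q$ is a finite quiver that is not $PI$, then $\operatorname{Id}(\mathbb{K}Q) = \operatorname{Id}(\mathbb{K}Q_{\geq 1}) = 0$. (ii) If $Q$ is a finite acyclic quiver, then $\operatorname{Id}(\mathbb{K}Q)$ is a proper subset of $\operatorname{Id}(\mathbb{K}Q_{\geq 1})$. (iii) If $Q$ is a finite quiver that is $PI$ but not acyclic, and for every vertex $i$ of $Q$ there exists a non-trivial path $p_i$ such that $s(p_i) = t(p_i) = i$, then $\operatorname{Id}(\mathbb{K}Q) = \operatorname{Id}(\mathbb{K}Q_{\geq 1})$.
   Context: A quiver $Q=(Q_0,Q_1,s,t)$ consists of a finite non-empty set $Q_0$ of vertices, a finite non-empty set $Q_1$ of arrows, and maps $s,t:Q_1\to Q_0$ (starting and terminal vertex). A path of length $n\ge 1$ (a non-trivial path) is a sequence $p=\alpha_1\cdots\alpha_n$ of arrows with $t(\alpha_i)=s(\alpha_{i+1})$; $s(p)=s(\alpha_1)$, $t(p)=t(\alpha_n)$. For each vertex $v$ there is a trivial path $e_v$ of length $0$ with $s(e_v)=t(e_v)=v$. $Q$ is acyclic if it has no non-trivial path $p$ with $s(p)=t(p)$. The path algebra $\mathbb{K}Q$ has as $\mathbb{K}$-basis all paths (including trivial ones); the product of paths $p,q$ is the concatenation $pq$ if $t(p)=s(q)$ and $0$ otherwise. The principal subalgebra $\mathbb{K}Q_{\ge 1}$ is the subalgebra of $\mathbb{K}Q$ spanned by all non-trivial paths. Let $X=\{x_1,x_2,\dots\}$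 be countably many non-commuting variables and $\mathbb{K}\langle X\rangle$ the free associative algebra. For an associative $\mathbb{K}$-algebra $A$, $\operatorname{Id}(A)$ is the set of $f\in\mathbb{K}\langle X\rangle$ that vanish under every substitution of elements of $A$ for the variables (if $A$ is non-unital, only $f$ with zero constant term are considered). $A$ is $PI$ if $\operatorname{Id}(A)\neq 0$. A quiver $Q$ is called $PI$ if $\mathbb{K}Q$ is $PI$. *)

theory Defs
  imports "Graph_Theory.Graph_Theory" "HOL-Library.Poly_Mapping"
begin

section \<open>Associative algebras and their polynomial identities\<close>

text \<open>
  An algebra need not have a unit and lives on a subset of an ambient abelian group, from which it
  takes addition and zero. Only the values of the operations on the carrier matter.
\<close>

record ('k, 'b) alg =
  acarrier :: "'b set"
  amult :: "'b \<Rightarrow> 'b \<Rightarrow> 'b"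
  ascale :: "'k \<Rightarrow> 'b \<Rightarrow> 'b"

locale assoc_alg = vector_space "ascale A" for A :: "('k::field, 'b::ab_group_add) alg" +
  assumes subspace_carrier: "subspace (acarrier A)"
    and mult_closed:
      "\<lbrakk>x \<in> acarrier A; y \<in> acarrier A\<rbrakk> \<Longrightarrow> amult A x y \<in> acarrier A"
    and mult_assoc:
      "\<lbrakk>x \<in> acarrier A; y \<in> acarrier A; z \<in> acarrier A\<rbrakk> \<Longrightarrow>
        amult A (amult A x y) z = amult A x (amult A y z)"
    and mult_add_left:
      "\<lbrakk>x \<in> acarrier A; y \<in> acarrier A; z \<in> acarrier A\<rbrakk> \<Longrightarrow>
        amult A (x + y) z = amult A x z + amult A y z"
    and mult_add_right:
      "\<lbrakk>x \<in> acarrier A; y \<in> acarrier A; z \<in> acarrier A\<rbrakk> \<Longrightarrow>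
        amult A x (y + z) = amult A x y + amult A x z"
    and mult_scale_left:
      "\<lbrakk>x \<in> acarrier A; y \<in> acarrier A\<rbrakk> \<Longrightarrow>
        amult A (ascale A c x) y = ascale A c (amult A x y)"
    and mult_scale_right:
      "\<lbrakk>x \<in> acarrier A; y \<in> acarrier A\<rbrakk> \<Longrightarrow>
        amult A x (ascale A c y) = ascale A c (amult A x y)"

definition is_unit_elem :: "('k, 'b) alg \<Rightarrow> 'b \<Rightarrow> bool" where
  "is_unit_elem A e \<longleftrightarrow>
     e \<in> acarrier A \<and> (\<forall>x\<in>acarrier A. amult A e x = x \<and> amult A x e = x)"

definition unital :: "('k, 'b) alg \<Rightarrow> bool" where
  "unital A \<longleftrightarrow> (\<exists>e. is_unit_elem A e)"

text \<open>
  The free unital associative algebra in the variables \<open>x\<^sub>0, x\<^sub>1, \<dots>\<close>, as a vector space: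
  its basis consists of the words in the variables, and a word is the list of the indices of its
  variables. The coefficient of the empty word is the constant term.
\<close>

type_synonym 'k free_alg = "nat list \<Rightarrow>\<^sub>0 'k"

text \<open>
  The empty word takes the unit of the algebra as its value. In a non-unital algebra this value is
  unspecified, but there it only ever appears with coefficient zero, see \<open>Id_alg\<close> below.
\<close>

fun eval_word :: "('k, 'b) alg \<Rightarrow> (nat \<Rightarrow> 'b) \<Rightarrow> nat list \<Rightarrow> 'b" where
  "eval_word A \<sigma> [] = (THE e. is_unit_elem A e)"
| "eval_word A \<sigma> [i] = \<sigma> i"
| "eval_word A \<sigma> (i # j # w) = amult A (\<sigma> i) (eval_word A \<sigma> (j # w))"

definition eval_poly ::
    "('k::zero, 'b::comm_monoid_add) alg \<Rightarrow> (nat \<Rightarrow> 'b) \<Rightarrow> 'k free_alg \<Rightarrow> 'b" where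
  "eval_poly A \<sigma> f = (\<Sum>w\<in>Poly_Mapping.keys f. ascale A (Poly_Mapping.lookup f w) (eval_word A \<sigma> w))"

definition Id_alg :: "('k::zero, 'b::comm_monoid_add) alg \<Rightarrow> 'k free_alg set" where
  "Id_alg A = {f. (\<not> unital A \<longrightarrow> Poly_Mapping.lookup f [] = 0) \<and>
              (\<forall>\<sigma>. (\<forall>i. \<sigma> i \<in> acarrier A) \<longrightarrow> eval_poly A \<sigma> f = 0)}"

definition PI_alg :: "('k::zero, 'b::comm_monoid_add) alg \<Rightarrow> bool" where
  "PI_alg A \<longleftrightarrow> Id_alg A \<noteq> {0}"

lemma (in assoc_alg) is_unit_elem_unique:
  assumes "is_unit_elem A e" "is_unit_elem A e'"
  shows "e = e'"
  using assms unfolding is_unit_elem_def by metis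

lemma (in assoc_alg) is_unit_elem_the:
  assumes "is_unit_elem A e"
  shows "(THE e. is_unit_elem A e) = e"
  using assms is_unit_elem_unique by (intro the_equality) auto

section \<open>Quivers and paths\<close>

text \<open>
  Starting and terminal vertex of an arrow are called \<open>tail\<close> and \<open>head\<close> in the graph library.
  There, loops and parallel arcs are allowed in \<open>fin_digraph\<close>.
\<close>

locale finite_quiver = fin_digraph Q for Q :: "('v, 'a) pre_digraph" +
  assumes verts_nonempty: "verts Q \<noteq> {}"
    and arcs_nonempty: "arcs Q \<noteq> {}"

text \<open>
  A path is given by its starting vertex and its sequence of arrows. The trivial path at \<open>v\<close>
  is \<open>(v, [])\<close>; for a non-trivial path the starting vertex is redundant, since \<open>awalk\<close>
  forces it to be the tail of the first arrow.
\<close>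

type_synonym ('v, 'a) qpath = "'v \<times> 'a list"

definition qpaths :: "('v, 'a) pre_digraph \<Rightarrow> ('v, 'a) qpath set" where
  "qpaths Q = {(u, p). \<exists>v. pre_digraph.awalk Q u p v}"

definition nontrivial_qpaths :: "('v, 'a) pre_digraph \<Rightarrow> ('v, 'a) qpath set" where
  "nontrivial_qpaths Q = {p \<in> qpaths Q. snd p \<noteq> []}"

definition qstart :: "('v, 'a) qpath \<Rightarrow> 'v" where
  "qstart p = fst p"

definition qend :: "('v, 'a) pre_digraph \<Rightarrow> ('v, 'a) qpath \<Rightarrow> 'v" where
  "qend Q p = pre_digraph.awlast Q (fst p) (snd p)"

definition qconcat :: "('v, 'a) qpath \<Rightarrow> ('v, 'a) qpath \<Rightarrow> ('v, 'a) qpath" where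
  "qconcat p q = (fst p, snd p @ snd q)"

definition acyclic_quiver :: "('v, 'a) pre_digraph \<Rightarrow> bool" where
  "acyclic_quiver Q \<longleftrightarrow> \<not> (\<exists>p\<in>nontrivial_qpaths Q. qstart p = qend Q p)"

section \<open>The path algebra\<close>

definition path_mult ::
    "('v, 'a) pre_digraph \<Rightarrow> (('v, 'a) qpath \<Rightarrow>\<^sub>0 'k) \<Rightarrow> (('v, 'a) qpath \<Rightarrow>\<^sub>0 'k)
      \<Rightarrow> (('v, 'a) qpath \<Rightarrow>\<^sub>0 'k::comm_ring_1)" where
  "path_mult Q f g =
     (\<Sum>p\<in>Poly_Mapping.keys f. \<Sum>q\<in>Poly_Mapping.keys g.
        if qend Q p = qstart q then Poly_Mapping.single (qconcat p q) (Poly_Mapping.lookup f p * Poly_Mapping.lookup g q)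
        else 0)"

definition path_scale ::
    "'k \<Rightarrow> (('v, 'a) qpath \<Rightarrow>\<^sub>0 'k) \<Rightarrow> (('v, 'a) qpath \<Rightarrow>\<^sub>0 'k::comm_ring_1)" where
  "path_scale c f = Poly_Mapping.map (\<lambda>a. c * a) f"

text \<open>The first argument of the algebras below only serves to name the ground field.\<close>

definition path_algebra ::
    "'k itself \<Rightarrow> ('v, 'a) pre_digraph \<Rightarrow> ('k::comm_ring_1, ('v, 'a) qpath \<Rightarrow>\<^sub>0 'k) alg" where
  "path_algebra K Q =
     \<lparr>acarrier = {f. Poly_Mapping.keys f \<subseteq> qpaths Q}, amult = path_mult Q, ascale = path_scale\<rparr>"

definition principal_subalgebra ::
    "'k itself \<Rightarrow> ('v, 'a) pre_digraph \<Rightarrow> ('k::comm_ring_1, ('v, 'a) qpath \<Rightarrow>\<^sub>0 'k) alg" where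
  "principal_subalgebra K Q =
     \<lparr>acarrier = {f. Poly_Mapping.keys f \<subseteq> nontrivial_qpaths Q}, amult = path_mult Q, ascale = path_scale\<rparr>"

definition PI_quiver :: "'k::comm_ring_1 itself \<Rightarrow> ('v, 'a) pre_digraph \<Rightarrow> bool" where
  "PI_quiver K Q \<longleftrightarrow> PI_alg (path_algebra K Q)"

subsection \<open>Basic properties\<close>

lemma lookup_path_scale [simp]: "Poly_Mapping.lookup (path_scale c f) p = c * Poly_Mapping.lookup f p"
  unfolding path_scale_def by (simp add: Poly_Mapping.map.rep_eq when_def)

lemma vector_space_path_scale:
  "vector_space (path_scale :: 'k::field \<Rightarrow> (('v, 'a) qpath \<Rightarrow>\<^sub>0 'k) \<Rightarrow> _)"
  by unfold_locales (auto intro!: poly_mapping_eqI simp: lookup_add algebra_simps)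

lemma keys_path_scale: "Poly_Mapping.keys (path_scale c f) \<subseteq> Poly_Mapping.keys f"
  by (auto simp: in_keys_iff)

lemma subspace_keys:
  "module.subspace (path_scale :: 'k::field \<Rightarrow> (('v, 'a) qpath \<Rightarrow>\<^sub>0 'k) \<Rightarrow> _) {f. Poly_Mapping.keys f \<subseteq> S}"
proof -
  interpret vector_space "path_scale :: 'k \<Rightarrow> (('v, 'a) qpath \<Rightarrow>\<^sub>0 'k) \<Rightarrow> _"
    by (rule vector_space_path_scale)
  show ?thesis
    unfolding subspace_def
    by (auto dest!: subsetD[OF keys_add] subsetD[OF keys_path_scale])
qed

lemma poly_mapping_expand: "f = (\<Sum>p\<in>Poly_Mapping.keys f. Poly_Mapping.single p (Poly_Mapping.lookup f p))"
  by (rule poly_mapping_eqI) (simp add: lookup_sum lookup_single when_def in_keys_iff)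

lemma span_single:
  "module.span (path_scale :: 'k::field \<Rightarrow> (('v, 'a) qpath \<Rightarrow>\<^sub>0 'k) \<Rightarrow> _)
     ((\<lambda>p. Poly_Mapping.single p 1) ` S) = {f. Poly_Mapping.keys f \<subseteq> S}"
proof -
  interpret vector_space "path_scale :: 'k \<Rightarrow> (('v, 'a) qpath \<Rightarrow>\<^sub>0 'k) \<Rightarrow> _"
    by (rule vector_space_path_scale)
  let ?B = "(\<lambda>p. Poly_Mapping.single p (1::'k)) ` S"
  show ?thesis
  proof
    show "span ?B \<subseteq> {f. Poly_Mapping.keys f \<subseteq> S}"
      by (rule span_minimal) (auto simp: subspace_keys)
    show "{f. Poly_Mapping.keys f \<subseteq> S} \<subseteq> span ?B"
    proof
      fix f :: "('v, 'a) qpath \<Rightarrow>\<^sub>0 'k" assume "f \<in> {f. Poly_Mapping.keys f \<subseteq> S}"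
      then have *: "Poly_Mapping.single p 1 \<in> span ?B" if "p \<in> Poly_Mapping.keys f" for p
        using that by (auto intro: span_base)
      have eq: "Poly_Mapping.single p (Poly_Mapping.lookup f p) = path_scale (Poly_Mapping.lookup f p) (Poly_Mapping.single p 1)"
        for p by (rule poly_mapping_eqI) (simp add: lookup_single when_def)
      have "(\<Sum>p\<in>Poly_Mapping.keys f. Poly_Mapping.single p (Poly_Mapping.lookup f p)) \<in> span ?B"
        by (rule span_sum) (simp add: eq * span_scale)
      then show "f \<in> span ?B" by (simp only: poly_mapping_expand[symmetric])
    qed
  qed
qed

lemma path_mult_superset:
  assumes "finite S" "finite T" "Poly_Mapping.keys f \<subseteq> S" "Poly_Mapping.keys g \<subseteq> T"
  shows "path_mult Q f g =
     (\<Sum>p\<in>S. \<Sum>q\<in>T.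
        if qend Q p = qstart q then Poly_Mapping.single (qconcat p q) (Poly_Mapping.lookup f p * Poly_Mapping.lookup g q)
        else 0)" (is "_ = (\<Sum>p\<in>S. \<Sum>q\<in>T. ?t p q)")
proof -
  have "path_mult Q f g = (\<Sum>p\<in>Poly_Mapping.keys f. \<Sum>q\<in>T. ?t p q)"
    unfolding path_mult_def
    by (intro sum.cong refl sum.mono_neutral_left) (use assms in \<open>auto simp: in_keys_iff\<close>)
  also have "\<dots> = (\<Sum>p\<in>S. \<Sum>q\<in>T. ?t p q)"
    by (rule sum.mono_neutral_left) (use assms in \<open>auto simp: in_keys_iff intro!: sum.neutral\<close>)
  finally show ?thesis .
qed

lemma path_mult_add_left: "path_mult Q (f + g) h = path_mult Q f h + path_mult Q g h"
proof -
  let ?S = "Poly_Mapping.keys f \<union> Poly_Mapping.keys g"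
  have eq: "path_mult Q k h = (\<Sum>p\<in>?S. \<Sum>q\<in>Poly_Mapping.keys h.
      if qend Q p = qstart q
      then Poly_Mapping.single (qconcat p q) (Poly_Mapping.lookup k p * Poly_Mapping.lookup h q)
      else 0)"
    if "Poly_Mapping.keys k \<subseteq> ?S" for k
    by (rule path_mult_superset) (use that in auto)
  show ?thesis
    unfolding eq[OF keys_add] eq[OF Un_upper1] eq[OF Un_upper2] sum.distrib[symmetric]
    by (intro sum.cong refl) (simp add: lookup_add distrib_right single_add)
qed

lemma path_mult_add_right: "path_mult Q h (f + g) = path_mult Q h f + path_mult Q h g"
proof -
  let ?T = "Poly_Mapping.keys f \<union> Poly_Mapping.keys g"
  have eq: "path_mult Q h k = (\<Sum>p\<in>Poly_Mapping.keys h. \<Sum>q\<in>?T.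
      if qend Q p = qstart q
      then Poly_Mapping.single (qconcat p q) (Poly_Mapping.lookup h p * Poly_Mapping.lookup k q)
      else 0)"
    if "Poly_Mapping.keys k \<subseteq> ?T" for k
    by (rule path_mult_superset) (use that in auto)
  show ?thesis
    unfolding eq[OF keys_add] eq[OF Un_upper1] eq[OF Un_upper2] sum.distrib[symmetric]
    by (intro sum.cong refl) (simp add: lookup_add distrib_left single_add)
qed

lemma path_scale_0_right [simp]: "path_scale c 0 = 0"
  by (rule poly_mapping_eqI) simp

lemma path_scale_add: "path_scale c (f + g) = path_scale c f + path_scale c g"
  by (rule poly_mapping_eqI) (simp add: lookup_add algebra_simps)

lemma path_scale_sum: "path_scale c (sum f S) = (\<Sum>x\<in>S. path_scale c (f x))"
  by (induction S rule: infinite_finite_induct) (auto simp: path_scale_add)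

lemma path_scale_single: "path_scale c (Poly_Mapping.single p a) = Poly_Mapping.single p (c * a)"
  by (rule poly_mapping_eqI) (simp add: lookup_single when_def)

lemma path_mult_scale_left: "path_mult Q (path_scale c f) g = path_scale c (path_mult Q f g)"
  by (simp add: path_mult_superset[where S = "Poly_Mapping.keys f" and T = "Poly_Mapping.keys g"] keys_path_scale
      path_scale_sum path_scale_single if_distrib[of "path_scale c"] mult.assoc cong: if_cong)

lemma path_mult_scale_right: "path_mult Q f (path_scale c g) = path_scale c (path_mult Q f g)"
  by (simp add: path_mult_superset[where S = "Poly_Mapping.keys f" and T = "Poly_Mapping.keys g"] keys_path_scale
      path_scale_sum path_scale_single if_distrib[of "path_scale c"] mult.left_commute
      cong: if_cong)

lemma path_mult_zero [simp]: "path_mult Q 0 g = 0" "path_mult Q f 0 = 0"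
  by (simp_all add: path_mult_def)

lemma path_mult_sum_left: "path_mult Q (sum f S) g = (\<Sum>x\<in>S. path_mult Q (f x) g)"
  by (induction S rule: infinite_finite_induct) (auto simp: path_mult_add_left)

lemma path_mult_sum_right: "path_mult Q g (sum f S) = (\<Sum>x\<in>S. path_mult Q g (f x))"
  by (induction S rule: infinite_finite_induct) (auto simp: path_mult_add_right)

lemma path_mult_single:
  "path_mult Q (Poly_Mapping.single p a) (Poly_Mapping.single q b) =
     (if qend Q p = qstart q then Poly_Mapping.single (qconcat p q) (a * b) else 0)"
  by (subst path_mult_superset[where S = "{p}" and T = "{q}"]) auto

lemma qend_qconcat: "qend Q p = qstart q \<Longrightarrow> qend Q (qconcat p q) = qend Q q"
  by (auto simp: qend_def qconcat_def qstart_def pre_digraph.awalk_verts_conv)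

lemma path_mult_assoc:
  fixes f g h :: "('v, 'a) qpath \<Rightarrow>\<^sub>0 'c::comm_ring_1"
  shows "path_mult Q (path_mult Q f g) h = path_mult Q f (path_mult Q g h)"
proof -
  have single: "path_mult Q (path_mult Q (Poly_Mapping.single p a) (Poly_Mapping.single q b))
      (Poly_Mapping.single r c) =
    path_mult Q (Poly_Mapping.single p a)
      (path_mult Q (Poly_Mapping.single q b) (Poly_Mapping.single r c))" for p q r and a b c :: 'c
    by (auto simp: path_mult_single qend_qconcat mult.assoc)
      (auto simp: qconcat_def qstart_def)
  have "path_mult Q (path_mult Q
        (\<Sum>p\<in>Poly_Mapping.keys f. Poly_Mapping.single p (Poly_Mapping.lookup f p))
        (\<Sum>p\<in>Poly_Mapping.keys g. Poly_Mapping.single p (Poly_Mapping.lookup g p)))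
        (\<Sum>p\<in>Poly_Mapping.keys h. Poly_Mapping.single p (Poly_Mapping.lookup h p)) =
    path_mult Q
        (\<Sum>p\<in>Poly_Mapping.keys f. Poly_Mapping.single p (Poly_Mapping.lookup f p))
        (path_mult Q
        (\<Sum>p\<in>Poly_Mapping.keys g. Poly_Mapping.single p (Poly_Mapping.lookup g p))
        (\<Sum>p\<in>Poly_Mapping.keys h. Poly_Mapping.single p (Poly_Mapping.lookup h p)))"
    by (simp only: path_mult_sum_left path_mult_sum_right single)
  then show ?thesis by (simp only: poly_mapping_expand[symmetric])
qed

context finite_quiver
begin

lemma qpaths_qconcat:
  assumes "p \<in> qpaths Q" "q \<in> qpaths Q" "qend Q p = qstart q"
  shows "qconcat p q \<in> qpaths Q"
proof -
  obtain v w where v: "awalk (fst p) (snd p) v" and w: "awalk (fst q) (snd q) w"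
    using assms(1,2) by (auto simp: qpaths_def)
  from v assms(3) have "v = fst q"
    by (auto simp: qend_def qstart_def)
  with v w have "awalk (fst p) (snd p @ snd q) w"
    by (auto intro: awalk_appendI)
  then show ?thesis by (auto simp: qpaths_def qconcat_def)
qed

lemma nontrivial_qpaths_qconcat:
  assumes "p \<in> nontrivial_qpaths Q" "q \<in> nontrivial_qpaths Q" "qend Q p = qstart q"
  shows "qconcat p q \<in> nontrivial_qpaths Q"
  using assms qpaths_qconcat[of p q] by (auto simp: nontrivial_qpaths_def qconcat_def)

lemma keys_path_mult:
  assumes "Poly_Mapping.keys f \<subseteq> S" "Poly_Mapping.keys g \<subseteq> S"
    and "\<And>p q. p \<in> S \<Longrightarrow> q \<in> S \<Longrightarrow> qend Q p = qstart q \<Longrightarrow> qconcat p q \<in> T"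
  shows "Poly_Mapping.keys (path_mult Q f g) \<subseteq> T"
proof -
  have "Poly_Mapping.lookup (path_mult Q f g) r = 0" if "r \<notin> T" for r
    unfolding path_mult_def lookup_sum
  proof (intro sum.neutral ballI)
    fix p q assume "p \<in> Poly_Mapping.keys f" "q \<in> Poly_Mapping.keys g"
    then have "qend Q p = qstart q \<Longrightarrow> qconcat p q \<noteq> r"
      using assms that by blast
    then show "Poly_Mapping.lookup
      (if qend Q p = qstart q
       then Poly_Mapping.single (qconcat p q) (Poly_Mapping.lookup f p * Poly_Mapping.lookup g q)
       else 0) r = 0"
      by (simp add: lookup_single when_def)
  qed
  then show ?thesis by (auto simp: in_keys_iff)
qed

lemma assoc_alg_path_algebra: "assoc_alg (path_algebra (K :: 'k::field itself) Q)"
proof -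
  have eqs: "ascale (path_algebra K Q) = path_scale" "amult (path_algebra K Q) = path_mult Q"
    "acarrier (path_algebra K Q) = {f. Poly_Mapping.keys f \<subseteq> qpaths Q}"
    by (simp_all add: path_algebra_def)
  show ?thesis
    unfolding assoc_alg_def assoc_alg_axioms_def eqs
    by (simp add: vector_space_path_scale subspace_keys keys_path_mult[OF _ _ qpaths_qconcat]
        path_mult_assoc path_mult_add_left path_mult_add_right path_mult_scale_left
        path_mult_scale_right)
qed

lemma assoc_alg_principal_subalgebra: "assoc_alg (principal_subalgebra (K :: 'k::field itself) Q)"
proof -
  have eqs: "ascale (principal_subalgebra K Q) = path_scale"
    "amult (principal_subalgebra K Q) = path_mult Q"
    "acarrier (principal_subalgebra K Q) = {f. Poly_Mapping.keys f \<subseteq> nontrivial_qpaths Q}"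
    by (simp_all add: principal_subalgebra_def)
  show ?thesis
    unfolding assoc_alg_def assoc_alg_axioms_def eqs
    by (simp add: vector_space_path_scale subspace_keys keys_path_mult[OF _ _ nontrivial_qpaths_qconcat]
        path_mult_assoc path_mult_add_left path_mult_add_right path_mult_scale_left
        path_mult_scale_right)
qed

lemma unital_path_algebra: "unital (path_algebra (K :: 'k::field itself) Q)"
proof -
  let ?e = "\<Sum>v\<in>verts Q. Poly_Mapping.single (v, []) (1::'k)"
  have "(v, []) \<in> qpaths Q" if "v \<in> verts Q" for v
    using that by (auto simp: qpaths_def awalk_def)
  then have "Poly_Mapping.keys ?e \<subseteq> qpaths Q"
    using keys_sum[of "\<lambda>v. Poly_Mapping.single (v, []) (1::'k)" "verts Q"]
    by (fastforce split: if_splits)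
  moreover have "path_mult Q ?e f = f" "path_mult Q f ?e = f"
    if f: "Poly_Mapping.keys f \<subseteq> qpaths Q" for f
  proof -
    have single: "path_mult Q ?e (Poly_Mapping.single p a) = Poly_Mapping.single p a"
      "path_mult Q (Poly_Mapping.single p a) ?e = Poly_Mapping.single p a"
      if pf: "p \<in> Poly_Mapping.keys f" for p a
    proof -
      obtain v where "awalk (fst p) (snd p) v"
        using subsetD[OF f pf] by (auto simp: qpaths_def)
      then have "qstart p \<in> verts Q" "qend Q p \<in> verts Q"
        by (auto simp: qstart_def qend_def)
      then show "path_mult Q ?e (Poly_Mapping.single p a) = Poly_Mapping.single p a"
        "path_mult Q (Poly_Mapping.single p a) ?e = Poly_Mapping.single p a"
        by (simp_all add: path_mult_sum_left path_mult_sum_right path_mult_single)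
          (simp_all add: qstart_def qend_def qconcat_def)
    qed
    let ?s = "\<Sum>p\<in>Poly_Mapping.keys f. Poly_Mapping.single p (Poly_Mapping.lookup f p)"
    have "path_mult Q ?e ?s = ?s"
      by (subst path_mult_sum_right, rule sum.cong) (simp_all add: single)
    then show "path_mult Q ?e f = f" by (simp only: poly_mapping_expand[symmetric])
    have "path_mult Q ?s ?e = ?s"
      by (subst path_mult_sum_left, rule sum.cong) (simp_all add: single)
    then show "path_mult Q f ?e = f" by (simp only: poly_mapping_expand[symmetric])
  qed
  ultimately have "is_unit_elem (path_algebra K Q) ?e"
    by (simp add: is_unit_elem_def path_algebra_def)
  then show ?thesis by (auto simp: unital_def)
qed

lemma not_unital_principal_subalgebra:
  "\<not> unital (principal_subalgebra (K :: 'k::field itself) Q)"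
proof
  assume "unital (principal_subalgebra K Q)"
  then obtain e :: "('v, 'a) qpath \<Rightarrow>\<^sub>0 'k" where e: "Poly_Mapping.keys e \<subseteq> nontrivial_qpaths Q"
    and unit: "\<And>f. Poly_Mapping.keys f \<subseteq> nontrivial_qpaths Q \<Longrightarrow> path_mult Q e f = f"
    by (auto simp: unital_def is_unit_elem_def principal_subalgebra_def)
  obtain a where a: "a \<in> arcs Q" using arcs_nonempty by blast
  let ?p = "(tail Q a, [a])"
  have p: "?p \<in> nontrivial_qpaths Q"
    using a by (auto simp: nontrivial_qpaths_def qpaths_def awalk_def)
  have "Poly_Mapping.keys (path_mult Q e (Poly_Mapping.single ?p 1)) \<subseteq> {p. length (snd p) \<ge> 2}"
  proof (rule keys_path_mult[OF e])
    show "Poly_Mapping.keys (Poly_Mapping.single ?p (1::'k)) \<subseteq> nontrivial_qpaths Q"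
      using p by simp
    show "qconcat p q \<in> {p. length (snd p) \<ge> 2}"
      if "p \<in> nontrivial_qpaths Q" "q \<in> nontrivial_qpaths Q" for p q
      using that by (cases "snd p"; cases "snd q") (auto simp: nontrivial_qpaths_def qconcat_def)
  qed
  moreover have "path_mult Q e (Poly_Mapping.single ?p 1) = Poly_Mapping.single ?p 1"
    using unit p by simp
  ultimately show False by simp
qed

end

end

theory Submission
  imports Defs "HOL-Combinatorics.Multiset_Permutations"
begin

text \<open>
  Call a quiver branching if some vertex carries two closed walks with different first arrows
  \<open>c\<close> and \<open>d\<close>. Then the walks \<open>c\<^sup>n d\<close> with \<open>n \<ge> 1\<close> freely generate a free algebra
  inside the principal subalgebra, so there is no identity at all.

  In a quiver that is not branching, a walk is determined by its starting vertex and the multiset of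
  its arrows. Hence all non-zero products of given paths in any order agree as soon as they start at
  the same vertex, and whether a product is non-zero depends only on the end points of the factors.
  For a multilinear polynomial of degree \<open>n\<close>, being an identity therefore amounts to at most
  \<open>N\<^bsup>2n+1\<^esup>\<close> linear conditions on its \<open>n!\<close> coefficients, where \<open>N\<close> is the number of vertices.
  So there is an identity, and being branching is the same as not being \<open>PI\<close>.

  If in addition every vertex lies on a closed walk, then each path, trivial or not, can be replaced
  by an arbitrarily long one with the same end points. If the new lengths grow fast enough, the length
  of a product determines the multiset of its factors. This lets the coefficients of a value on the
  path algebra be recovered from a value on the principal subalgebra.

  In an acyclic quiver long products of non-trivial paths vanish, whereas a trivial path is idempotent.
\<close>

subsection \<open>Linear systems, factorials and weights\<close>

text \<open>Gaussian elimination, by induction on the equations: one equation is solved for an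
  unknown with non-zero coefficient and substituted into the others, which leaves one equation and
  one unknown fewer.\<close>

lemma underdetermined_system:
  fixes c :: "'i \<Rightarrow> 'j \<Rightarrow> 'k::field"
  assumes "finite I" "finite J" "card I < card J"
  shows "\<exists>a. (\<exists>j\<in>J. a j \<noteq> 0) \<and> (\<forall>i\<in>I. (\<Sum>j\<in>J. c i j * a j) = 0)"
  using assms
proof (induction I arbitrary: J c rule: finite_induct)
  case empty
  then have "J \<noteq> {}" by auto
  then show ?case by (intro exI[of _ "\<lambda>_. 1"]) auto
next
  case (insert i I)
  show ?case
  proof (cases "\<forall>j\<in>J. c i j = 0")
    case True
    obtain a where "\<exists>j\<in>J. a j \<noteq> 0" "\<forall>i\<in>I. (\<Sum>j\<in>J. c i j * a j) = 0"
      using insert.IH[of J c] insert.prems insert.hyps by auto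
    then show ?thesis using True by (intro exI[of _ a]) auto
  next
    case False
    then obtain j0 where j0: "j0 \<in> J" "c i j0 \<noteq> 0" by blast
    \<comment> \<open>Eliminating the unknown \<open>j0\<close> by means of equation
      \<open>i\<close> turns the coefficient \<open>c i' j\<close> into
      \<open>c i' j - c i' j0 * c i j / c i j0\<close>.\<close>
    define J' where "J' = J - {j0}"
    have J': "finite J'" "card I < card J'" "j0 \<notin> J'" "J = insert j0 J'"
      using insert.prems insert.hyps j0 by (auto simp: J'_def card_Diff_singleton)
    obtain a where a: "\<exists>j\<in>J'. a j \<noteq> 0"
        "\<forall>i'\<in>I. (\<Sum>j\<in>J'. (c i' j - c i' j0 * c i j / c i j0) * a j) = 0"
      using insert.IH[of J' "\<lambda>i' j. c i' j - c i' j0 * c i j / c i j0"] J' by blast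
    define s where "s = (\<Sum>j\<in>J'. c i j * a j)"
    \<comment> \<open>The value at \<open>j0\<close> is the one that equation \<open>i\<close>
      forces.\<close>
    define b where "b = a(j0 := - s / c i j0)"
    have b: "(\<Sum>j\<in>J. c i' j * b j) = (\<Sum>j\<in>J'. c i' j * a j) - c i' j0 * s / c i j0" for i'
    proof -
      have "(\<Sum>j\<in>J'. c i' j * b j) = (\<Sum>j\<in>J'. c i' j * a j)"
        using J' by (intro sum.cong) (auto simp: b_def)
      then show ?thesis using J' by (simp add: b_def)
    qed
    have "(\<Sum>j\<in>J. c i' j * b j) = 0" if "i' \<in> I" for i'
    proof -
      have "(\<Sum>j\<in>J'. (c i' j - c i' j0 * c i j / c i j0) * a j)
        = (\<Sum>j\<in>J'. c i' j * a j) - c i' j0 / c i j0 * s"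
        by (simp add: s_def sum_distrib_left sum_subtractf algebra_simps)
      with a(2) that show ?thesis by (simp add: b)
    qed
    moreover have "(\<Sum>j\<in>J. c i j * b j) = 0"
      using j0 by (simp add: b s_def)
    moreover have "\<exists>j\<in>J. b j \<noteq> 0"
      using a(1) J' by (auto simp: b_def)
    ultimately show ?thesis by (intro exI[of _ b]) auto
  qed
qed

text \<open>The terms \<open>M ^ n / n!\<close> of the exponential series tend to 0. The inequality
  is what lets the coefficients of a multilinear polynomial outnumber the linear conditions on
  them.\<close>

lemma fact_gt_exponential: "\<exists>n>0. N * M ^ n < fact n" for N M :: nat
proof -
  have "(\<lambda>n. inverse (fact n) * real M ^ n) \<longlonglongrightarrow> 0"
    by (rule summable_LIMSEQ_zero[OF summable_exp])
  \<comment> \<open>Dividing by \<open>N + 1\<close> rather than \<open>N\<close> keeps the bound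
    positive for \<open>N = 0\<close>.\<close>
  then have "\<forall>\<^sub>F n in sequentially. inverse (fact n) * real M ^ n < 1 / (real N + 1)"
    by (rule order_tendstoD) simp
  then have "\<forall>\<^sub>F n in sequentially. inverse (fact n) * real M ^ n < 1 / (real N + 1) \<and> n > 0"
    using eventually_gt_at_top[of 0] by (rule eventually_conj)
  then obtain n where n: "inverse (fact n) * real M ^ n < 1 / (real N + 1)" "n > 0"
    using eventually_happens'[OF sequentially_bot] by blast
  then have "(real N + 1) * real M ^ n < fact n"
    by (simp add: field_simps)
  moreover have "real N * real M ^ n \<le> (real N + 1) * real M ^ n"
    by (intro mult_right_mono) auto
  ultimately have "real (N * M ^ n) < real (fact n)" by simp
  then have "N * M ^ n < fact n" by (simp only: of_nat_less_iff)
  with n show ?thesis by blast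
qed

lemma sum_mset_le_size_mult:
  fixes g :: "'x \<Rightarrow> nat"
  assumes "set_mset M \<subseteq> S" "finite S"
  shows "(\<Sum>x\<in>#M. g x) \<le> size M * sum g S"
  using assms(1)
proof (induction M)
  case (add x M)
  then have "g x \<le> sum g S"
    using assms(2) by (intro member_le_sum) auto
  with add show ?case by auto
qed simp

text \<open>\<open>P x y\<close> says that \<open>y\<close> may replace \<open>x\<close>. The
  replacements are chosen one after the other, each longer than \<open>d\<close> times the sum of
  the earlier lengths. A total length is then read like a numeral in a positional system whose
  digits are the multiplicities of the elements.\<close>

lemma exists_fast_growing_choice:
  fixes len :: "'y \<Rightarrow> nat"
  assumes "finite S" "\<And>x n. x \<in> S \<Longrightarrow> \<exists>y. P x y \<and> n < len y"
  shows "\<exists>q. (\<forall>x\<in>S. P x (q x) \<and> 0 < len (q x)) \<and>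
    (\<forall>M N. set_mset M \<subseteq> S \<and> set_mset N \<subseteq> S \<and> size M \<le> d \<and> size N \<le> d \<and>
       (\<Sum>x\<in>#M. len (q x)) = (\<Sum>x\<in>#N. len (q x)) \<longrightarrow> M = N)"
  using assms
proof (induction S rule: finite_induct)
  case empty
  then show ?case by auto
next
  case (insert x S)
  obtain q where q: "\<And>y. y \<in> S \<Longrightarrow> P y (q y) \<and> 0 < len (q y)"
    and inj: "\<And>M N. set_mset M \<subseteq> S \<Longrightarrow> set_mset N \<subseteq> S \<Longrightarrow> size M \<le> d \<Longrightarrow> size N \<le> d \<Longrightarrow>
       (\<Sum>x\<in>#M. len (q x)) = (\<Sum>x\<in>#N. len (q x)) \<Longrightarrow> M = N"
    using insert.IH insert.prems by (metis insertCI)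
  \<comment> \<open>At most \<open>d\<close> elements of \<open>S\<close> have total length at most
    \<open>B\<close>.\<close>
  define B where "B = d * (\<Sum>y\<in>S. len (q y))"
  obtain z where z: "P x z" "B < len z" using insert.prems by blast
  define r where "r = q(x := z)"
  have split: "(\<Sum>y\<in>#M. len (r y)) = count M x * len z + (\<Sum>y\<in>#filter_mset (\<lambda>y. y \<noteq> x) M. len (q y))"
    for M
  proof -
    have "M = filter_mset (\<lambda>y. y \<noteq> x) M + filter_mset (\<lambda>y. y = x) M"
      by (metis (no_types, lifting) filter_mset_cong0 multiset_partition not_not union_commute)
    then have "M = filter_mset (\<lambda>y. y \<noteq> x) M + replicate_mset (count M x) x"
      by (simp only: filter_eq_replicate_mset)
    then have "(\<Sum>y\<in>#M. len (r y)) =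
        (\<Sum>y\<in>#filter_mset (\<lambda>y. y \<noteq> x) M + replicate_mset (count M x) x. len (r y))"
      by simp
    also have "\<dots> = (\<Sum>y\<in>#filter_mset (\<lambda>y. y \<noteq> x) M. len (r y)) + count M x * len z"
      by (simp add: r_def)
    also have "(\<Sum>y\<in>#filter_mset (\<lambda>y. y \<noteq> x) M. len (r y)) = (\<Sum>y\<in>#filter_mset (\<lambda>y. y \<noteq> x) M. len (q y))"
      by (intro arg_cong[of _ _ sum_mset] image_mset_cong) (auto simp: r_def)
    finally show ?thesis by simp
  qed
  have rest: "set_mset (filter_mset (\<lambda>y. y \<noteq> x) M) \<subseteq> S" "size (filter_mset (\<lambda>y. y \<noteq> x) M) \<le> d"
    if "set_mset M \<subseteq> insert x S" "size M \<le> d" for M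
    using that order_trans[OF size_filter_mset_lesseq that(2)] by auto
  have bound: "(\<Sum>y\<in>#filter_mset (\<lambda>y. y \<noteq> x) M. len (q y)) < len z"
    if "set_mset M \<subseteq> insert x S" "size M \<le> d" for M
  proof -
    have "(\<Sum>y\<in>#filter_mset (\<lambda>y. y \<noteq> x) M. len (q y))
        \<le> size (filter_mset (\<lambda>y. y \<noteq> x) M) * (\<Sum>y\<in>S. len (q y))"
      using rest[OF that] insert.hyps by (intro sum_mset_le_size_mult)
    also have "\<dots> \<le> B"
      unfolding B_def using rest[OF that] by (intro mult_right_mono) auto
    finally show ?thesis using z by simp
  qed
  have "M = N" if M: "set_mset M \<subseteq> insert x S" "size M \<le> d"
    and N: "set_mset N \<subseteq> insert x S" "size N \<le> d"
    and eq: "(\<Sum>x\<in>#M. len (r x)) = (\<Sum>x\<in>#N. len (r x))" for M N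
  proof -
    let ?m = "\<Sum>y\<in>#filter_mset (\<lambda>y. y \<noteq> x) M. len (q y)"
    let ?n = "\<Sum>y\<in>#filter_mset (\<lambda>y. y \<noteq> x) N. len (q y)"
    have eq': "count M x * len z + ?m = count N x * len z + ?n"
      using eq by (simp add: split)
    \<comment> \<open>\<open>?m\<close> and \<open>?n\<close> are smaller than \<open>len z\<close>,
      so division by \<open>len z\<close> recovers the multiplicity of \<open>x\<close>, and the
      remainder belongs to the earlier elements.\<close>
    have "count M x = (count M x * len z + ?m) div len z"
      using bound[OF M] by simp
    also have "\<dots> = count N x"
      unfolding eq' using bound[OF N] by simp
    finally have c: "count M x = count N x" .
    with eq' have "filter_mset (\<lambda>y. y \<noteq> x) M = filter_mset (\<lambda>y. y \<noteq> x) N"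
      by (intro inj rest M N) simp
    show "M = N"
    proof (rule multiset_eqI)
      fix y
      show "count M y = count N y"
      proof (cases "y = x")
        case False
        then have "count M y = count (filter_mset (\<lambda>y. y \<noteq> x) M) y" by simp
        also have "\<dots> = count N y"
          unfolding \<open>filter_mset (\<lambda>y. y \<noteq> x) M = _\<close> using False by simp
        finally show ?thesis .
      qed (simp add: c)
    qed
  qed
  moreover have "\<forall>y\<in>insert x S. P y (r y) \<and> 0 < len (r y)"
    using q z by (auto simp: r_def)
  ultimately show ?case by (intro exI[of _ r]) blast
qed

subsection \<open>Evaluation as a sum over sequences of paths\<close>

text \<open>Starting vertices of all but the first factor are dropped; in a composable sequence they
  are determined by the preceding factors. For the empty list the starting vertex is
  unspecified.\<close>

definition concat_qpaths :: "('v, 'a) qpath list \<Rightarrow> ('v, 'a) qpath" where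
  "concat_qpaths ps = (fst (hd ps), concat (map snd ps))"

definition composable :: "('v, 'a) pre_digraph \<Rightarrow> ('v, 'a) qpath list \<Rightarrow> bool" where
  "composable Q = successively (\<lambda>p q. qend Q p = qstart q)"

lemma composable_simps [simp]:
  "composable Q []" "composable Q [p]"
  "composable Q (p # q # ps) \<longleftrightarrow> qend Q p = qstart q \<and> composable Q (q # ps)"
  by (simp_all add: composable_def)

lemma composable_Cons: "ps \<noteq> [] \<Longrightarrow>
    composable Q (p # ps) \<longleftrightarrow> qend Q p = qstart (hd ps) \<and> composable Q ps"
  by (cases ps) auto

lemma qstart_concat_qpaths [simp]: "qstart (concat_qpaths ps) = qstart (hd ps)"
  by (simp add: concat_qpaths_def qstart_def)

lemma concat_qpaths_singleton [simp]: "concat_qpaths [p] = p"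
  by (simp add: concat_qpaths_def)

lemma concat_qpaths_Cons: "concat_qpaths (p # ps) = qconcat p (concat_qpaths ps)"
  by (simp add: concat_qpaths_def qconcat_def)

lemma (in finite_quiver) concat_qpaths_in_qpaths:
  assumes "composable Q ps" "ps \<noteq> []" "set ps \<subseteq> qpaths Q"
  shows "concat_qpaths ps \<in> qpaths Q"
  using assms(2,1,3)
proof (induction ps rule: list_nonempty_induct)
  case (cons p ps)
  then show ?case
    by (auto simp: concat_qpaths_Cons composable_Cons intro: qpaths_qconcat)
qed simp

text \<open>Distributivity: a term of the product arises by choosing, for each letter of
  \<open>w\<close>, one summand of the value of that variable. Summands are indexed by pairs whose
  first component is the variable; their paths are given by a separate map \<open>\<pi>\<close>, so
  that two substitutions can share the index set \<open>S\<close>.\<close>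

lemma eval_word_path_sum:
  fixes A :: "('k::field, ('v, 'a) qpath \<Rightarrow>\<^sub>0 'k) alg" and \<pi> :: "nat \<times> 'x \<Rightarrow> ('v, 'a) qpath"
  assumes mult: "amult A = path_mult Q" and fin: "finite S"
    and "w \<noteq> []"
    and "\<And>i. i \<in> set w \<Longrightarrow> \<sigma> i = (\<Sum>x | x \<in> S \<and> fst x = i. Poly_Mapping.single (\<pi> x) (c x))"
  shows "eval_word A \<sigma> w = (\<Sum>s | set s \<subseteq> S \<and> map fst s = w.
     if composable Q (map \<pi> s) then Poly_Mapping.single (concat_qpaths (map \<pi> s)) (\<Prod>x\<leftarrow>s. c x) else 0)"
  using assms(3,4)
proof (induction w rule: list_nonempty_induct)
  case (single i)
  have "{s. set s \<subseteq> S \<and> map fst s = [i]} = (\<lambda>x. [x]) ` {x. x \<in> S \<and> fst x = i}"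
    by (auto simp: map_eq_Cons_conv)
  then show ?case using single
    by (simp add: sum.reindex inj_on_def)
next
  case (cons i w)
  let ?X = "{x. x \<in> S \<and> fst x = i}" and ?B = "{s. set s \<subseteq> S \<and> map fst s = w}"
  let ?t = "\<lambda>s. if composable Q (map \<pi> s)
    then Poly_Mapping.single (concat_qpaths (map \<pi> s)) (\<Prod>x\<leftarrow>s. c x) else 0"
  have B: "s \<noteq> []" if "s \<in> ?B" for s using that \<open>w \<noteq> []\<close> by auto
  have set_eq: "{s. set s \<subseteq> S \<and> map fst s = i # w} = (\<lambda>(x, s). x # s) ` (?X \<times> ?B)"
    by (auto simp: map_eq_Cons_conv image_iff)
  have "eval_word A \<sigma> (i # w) = path_mult Q (\<sigma> i) (eval_word A \<sigma> w)"
    using \<open>w \<noteq> []\<close> mult by (cases w) auto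
  also have "\<dots> = (\<Sum>x\<in>?X. \<Sum>s\<in>?B. path_mult Q (Poly_Mapping.single (\<pi> x) (c x)) (?t s))"
    using cons by (simp add: path_mult_sum_left) (simp add: path_mult_sum_right)
  also have "\<dots> = (\<Sum>x\<in>?X. \<Sum>s\<in>?B. ?t (x # s))"
  proof (intro sum.cong refl)
    fix x s assume "s \<in> ?B"
    then have "map \<pi> s \<noteq> []" using B by simp
    then show "path_mult Q (Poly_Mapping.single (\<pi> x) (c x)) (?t s) = ?t (x # s)"
      by (simp add: path_mult_single composable_Cons concat_qpaths_Cons)
  qed
  also have "\<dots> = (\<Sum>(x, s)\<in>?X \<times> ?B. ?t (x # s))"
    by (rule sum.cartesian_product)
  also have "\<dots> = (\<Sum>s | set s \<subseteq> S \<and> map fst s = i # w. ?t s)"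
    unfolding set_eq by (subst sum.reindex) (auto simp: inj_on_def intro!: sum.cong)
  finally show ?case .
qed

text \<open>These are the sequences of summands that contribute to the coefficient of the path
  \<open>r\<close> when \<open>f\<close> is evaluated.\<close>

definition factorizations ::
    "('v, 'a) pre_digraph \<Rightarrow> 'k::zero free_alg \<Rightarrow> (nat \<times> 'x) set \<Rightarrow>
      (nat \<times> 'x \<Rightarrow> ('v, 'a) qpath) \<Rightarrow> ('v, 'a) qpath \<Rightarrow> (nat \<times> 'x) list set" where
  "factorizations Q f S \<pi> r = {s. set s \<subseteq> S \<and> map fst s \<in> Poly_Mapping.keys f \<and>
      composable Q (map \<pi> s) \<and> concat_qpaths (map \<pi> s) = r}"

lemma finite_words_over:
  assumes "finite S"
  shows "finite {s. set s \<subseteq> S \<and> map fst s \<in> Poly_Mapping.keys f}"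
proof (rule finite_subset)
  show "{s. set s \<subseteq> S \<and> map fst s \<in> Poly_Mapping.keys f}
    \<subseteq> (\<Union>w\<in>Poly_Mapping.keys f. {s. set s \<subseteq> S \<and> length s = length w})"
    by force
  show "finite (\<Union>w\<in>Poly_Mapping.keys f. {s. set s \<subseteq> S \<and> length s = length w})"
    using finite_lists_length_eq[OF assms] by auto
qed

lemma finite_factorizations: "finite S \<Longrightarrow> finite (factorizations Q f S \<pi> r)"
  by (rule finite_subset[OF _ finite_words_over[of S f]]) (auto simp: factorizations_def)

text \<open>A sequence \<open>s\<close> determines its word \<open>map fst s\<close>, so the sums
  over the words of \<open>f\<close> combine to a single sum. The zero constant term keeps out the
  empty word, whose value is not a product of paths.\<close>

lemma lookup_eval_poly:
  fixes A :: "('k::field, ('v, 'a) qpath \<Rightarrow>\<^sub>0 'k) alg" and \<pi> :: "nat \<times> 'x \<Rightarrow> ('v, 'a) qpath"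
  assumes A: "amult A = path_mult Q" "ascale A = path_scale" and fin: "finite S"
    and f0: "Poly_Mapping.lookup f [] = 0"
    and \<sigma>: "\<And>w i. w \<in> Poly_Mapping.keys f \<Longrightarrow> i \<in> set w \<Longrightarrow>
      \<sigma> i = (\<Sum>x | x \<in> S \<and> fst x = i. Poly_Mapping.single (\<pi> x) (c x))"
  shows "Poly_Mapping.lookup (eval_poly A \<sigma> f) r =
    (\<Sum>s\<in>factorizations Q f S \<pi> r. Poly_Mapping.lookup f (map fst s) * (\<Prod>x\<leftarrow>s. c x))"
proof -
  let ?T = "{s. set s \<subseteq> S \<and> map fst s \<in> Poly_Mapping.keys f}"
  let ?t = "\<lambda>s. if composable Q (map \<pi> s) \<and> concat_qpaths (map \<pi> s) = r
    then Poly_Mapping.lookup f (map fst s) * (\<Prod>x\<leftarrow>s. c x) else 0"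
  have "Poly_Mapping.lookup (eval_poly A \<sigma> f) r =
    (\<Sum>w\<in>Poly_Mapping.keys f. \<Sum>s | set s \<subseteq> S \<and> map fst s = w. ?t s)"
    unfolding eval_poly_def lookup_sum A
  proof (rule sum.cong[OF refl])
    fix w assume w: "w \<in> Poly_Mapping.keys f"
    then have "w \<noteq> []" using f0 by (auto simp: in_keys_iff)
    have "eval_word A \<sigma> w = (\<Sum>s | set s \<subseteq> S \<and> map fst s = w. if composable Q (map \<pi> s)
        then Poly_Mapping.single (concat_qpaths (map \<pi> s)) (\<Prod>x\<leftarrow>s. c x) else 0)"
      by (rule eval_word_path_sum[OF A(1) fin \<open>w \<noteq> []\<close> \<sigma>[OF w]])
    then show "Poly_Mapping.lookup (path_scale (Poly_Mapping.lookup f w) (eval_word A \<sigma> w)) r =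
        (\<Sum>s | set s \<subseteq> S \<and> map fst s = w. ?t s)"
      by (auto simp: lookup_sum sum_distrib_left lookup_single when_def intro!: sum.cong)
  qed
  also have "\<dots> = (\<Sum>w\<in>Poly_Mapping.keys f. \<Sum>s | s \<in> ?T \<and> map fst s = w. ?t s)"
    by (intro sum.cong refl) auto
  also have "\<dots> = (\<Sum>s\<in>?T. ?t s)"
    by (rule sum.group[OF finite_words_over[OF fin]]) auto
  also have "\<dots> = (\<Sum>s\<in>factorizations Q f S \<pi> r.
      Poly_Mapping.lookup f (map fst s) * (\<Prod>x\<leftarrow>s. c x))"
    by (rule sum.mono_neutral_cong_right[OF finite_words_over[OF fin]])
      (auto simp: factorizations_def)
  finally show ?thesis .
qed

text \<open>Only variables occurring in \<open>f\<close> are included, which keeps the set finite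
  although \<open>\<sigma>\<close> assigns values to infinitely many variables.\<close>

definition value_support ::
    "'k::zero free_alg \<Rightarrow> (nat \<Rightarrow> 'p \<Rightarrow>\<^sub>0 'k) \<Rightarrow> (nat \<times> 'p) set" where
  "value_support f \<sigma> = Sigma (\<Union>w\<in>Poly_Mapping.keys f. set w) (\<lambda>i. Poly_Mapping.keys (\<sigma> i))"

lemma finite_value_support: "finite (value_support f \<sigma>)"
  by (auto simp: value_support_def)

lemma snd_value_support:
  assumes "\<And>i. Poly_Mapping.keys (\<sigma> i) \<subseteq> T" "x \<in> value_support f \<sigma>"
  shows "snd x \<in> T"
  using assms unfolding value_support_def by (cases x) (simp, blast)

lemma expand_value_support:
  assumes "w \<in> Poly_Mapping.keys f" "i \<in> set w"
  shows "\<sigma> i = (\<Sum>x | x \<in> value_support f \<sigma> \<and> fst x = i.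
    Poly_Mapping.single (snd x) (Poly_Mapping.lookup (\<sigma> (fst x)) (snd x)))"
proof -
  have "{x. x \<in> value_support f \<sigma> \<and> fst x = i} = Pair i ` Poly_Mapping.keys (\<sigma> i)"
    using assms by (auto simp: value_support_def)
  then show ?thesis
    by (simp add: sum.reindex inj_on_def poly_mapping_expand[symmetric])
qed

lemma lookup_eval_poly_value_support:
  fixes A :: "('k::field, ('v, 'a) qpath \<Rightarrow>\<^sub>0 'k) alg"
  assumes "amult A = path_mult Q" "ascale A = path_scale" "Poly_Mapping.lookup f [] = 0"
  shows "Poly_Mapping.lookup (eval_poly A \<sigma> f) r =
    (\<Sum>s\<in>factorizations Q f (value_support f \<sigma>) snd r.
      Poly_Mapping.lookup f (map fst s) * (\<Prod>x\<leftarrow>s. Poly_Mapping.lookup (\<sigma> (fst x)) (snd x)))"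
  by (rule lookup_eval_poly[OF assms(1,2) finite_value_support assms(3) expand_value_support])

subsection \<open>Quivers with two closed walks that branch\<close>

definition branching :: "('v, 'a) pre_digraph \<Rightarrow> bool" where
  "branching Q \<longleftrightarrow> (\<exists>v c d. pre_digraph.awalk Q v c v \<and> pre_digraph.awalk Q v d v \<and>
     c \<noteq> [] \<and> d \<noteq> [] \<and> hd c \<noteq> hd d)"

text \<open>Read from the left, a further block \<open>c\<close> and the closing \<open>d\<close>
  are told apart by their first arrow, so the exponent in the first factor is determined and the
  factor can be cancelled.\<close>

lemma inj_concat_map_code:
  assumes "c \<noteq> []" "d \<noteq> []" "hd c \<noteq> hd d"
  shows "inj (\<lambda>w. concat (map (\<lambda>i. concat (replicate (Suc i) c) @ d) w))"
proof -
  let ?u = "\<lambda>i. concat (replicate (Suc i) c) @ d"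
  obtain a c' b d' where cd: "c = a # c'" "d = b # d'" "a \<noteq> b"
    using assms by (cases c; cases d) auto
  \<comment> \<open>Once the blocks \<open>c\<close> common to both sides are cancelled, unequal
    exponents would leave one side starting with \<open>hd c\<close> and the other with
    \<open>hd d\<close>.\<close>
  have u: "i = j" if "?u i @ x = ?u j @ y" for i j x y
    using that
  proof (induction i arbitrary: j)
    case 0
    then show ?case using cd by (cases j) auto
  next
    case (Suc i)
    then show ?case using cd by (cases j) auto
  qed
  have "w = w'" if "concat (map ?u w) = concat (map ?u w')" for w w'
    using that
  proof (induction w arbitrary: w')
    case Nil
    then show ?case using cd by (cases w') auto
  next
    case (Cons i w)
    then obtain j w'' where w': "w' = j # w''" using cd by (cases w') auto
    with Cons.prems have eq: "?u i @ concat (map ?u w) = ?u j @ concat (map ?u w'')" by simp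
    then have "i = j" by (rule u)
    moreover from this eq have "concat (map ?u w) = concat (map ?u w'')" by simp
    ultimately show ?case using Cons.IH w' by simp
  qed
  then show ?thesis by (auto simp: inj_def)
qed

lemma composable_cong:
  assumes "\<And>x. x \<in> set s \<Longrightarrow> qstart (\<pi> x) = qstart (\<rho> x)"
    and "\<And>x. x \<in> set s \<Longrightarrow> qend Q (\<pi> x) = qend Q (\<rho> x)"
  shows "composable Q (map \<pi> s) \<longleftrightarrow> composable Q (map \<rho> s)"
  unfolding composable_def successively_map using assms by (intro successively_cong) auto

text \<open>The sum ranges over a multiset, the form in which
  \<open>exists_fast_growing_choice\<close> compares total lengths.\<close>

lemma length_concat_qpaths:
  "length (snd (concat_qpaths (map \<pi> s))) = (\<Sum>x\<in>#mset s. length (snd (\<pi> x)))"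
  by (simp add: concat_qpaths_def length_concat o_def flip: sum_mset_sum_list)

text \<open>Carriers enter an evaluation only through the unit, that is, through the empty
  word.\<close>

lemma eval_poly_cong:
  assumes "amult A = amult B" "ascale A = ascale B" "Poly_Mapping.lookup f [] = 0"
  shows "eval_poly A \<sigma> f = eval_poly B \<sigma> f"
proof -
  have "eval_word A \<sigma> w = eval_word B \<sigma> w" if "w \<noteq> []" for w
    using that
  proof (induction w rule: list_nonempty_induct)
    case (cons i w)
    then show ?case using assms by (cases w) auto
  qed simp
  then show ?thesis
    unfolding eval_poly_def assms(2) using assms(3)
    by (intro sum.cong refl) (metis in_keys_iff)
qed

context finite_quiver
begin

lemma qpathsE:
  assumes "p \<in> qpaths Q"
  shows "awalk (qstart p) (snd p) (qend Q p)"
  using assms by (auto simp: qpaths_def qstart_def qend_def)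

lemma qpathsI:
  assumes "awalk u p v"
  shows "(u, p) \<in> qpaths Q" "qstart (u, p) = u" "qend Q (u, p) = v"
  using assms by (auto simp: qpaths_def qstart_def qend_def)

lemma awalk_replicate:
  assumes "awalk v c v"
  shows "awalk v (concat (replicate k c)) v"
  using assms by (induction k) (auto simp: awalk_Nil_iff intro: awalk_appendI)

text \<open>Substituting the closed walk \<open>u i\<close> for the variable \<open>i\<close> sends
  distinct non-empty words to distinct paths, so each coefficient of \<open>f\<close> shows up as a
  coefficient of the value.\<close>

lemma Id_principal_subalgebra_branching:
  assumes "branching Q"
  shows "Id_alg (principal_subalgebra (K :: 'k::field itself) Q) = {0}"
proof -
  let ?A = "principal_subalgebra K Q"
  have A: "amult ?A = path_mult Q" "ascale ?A = path_scale"
    "acarrier ?A = {f. Poly_Mapping.keys f \<subseteq> nontrivial_qpaths Q}"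
    by (simp_all add: principal_subalgebra_def)
  obtain v c d where cd: "awalk v c v" "awalk v d v" "c \<noteq> []" "d \<noteq> []" "hd c \<noteq> hd d"
    using assms unfolding branching_def by blast
  define u where "u i = concat (replicate (Suc i) c) @ d" for i
  let ?\<sigma> = "\<lambda>i. Poly_Mapping.single (v, u i) (1 :: 'k)"
  have u: "awalk v (u i) v" for i
    unfolding u_def using awalk_replicate[OF cd(1)] cd(2) by (rule awalk_appendI)
  have carrier: "?\<sigma> i \<in> acarrier ?A" for i
    using qpathsI(1)[OF u[of i]] cd by (auto simp: A nontrivial_qpaths_def u_def)
  have word: "eval_word ?A ?\<sigma> w = Poly_Mapping.single (v, concat (map u w)) 1" if "w \<noteq> []" for w
    using that
  proof (induction w rule: list_nonempty_induct)
    case (cons i w)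
    then have "eval_word ?A ?\<sigma> (i # w) =
        path_mult Q (?\<sigma> i) (Poly_Mapping.single (v, concat (map u w)) 1)"
      by (cases w) (auto simp: A)
    also have "\<dots> = Poly_Mapping.single (v, concat (map u (i # w))) 1"
      unfolding path_mult_single qpathsI(3)[OF u] by (simp add: qstart_def qconcat_def)
    finally show ?case .
  qed simp
  have "f = 0" if f: "f \<in> Id_alg ?A" for f
  proof (rule poly_mapping_eqI)
    fix w
    have f0: "Poly_Mapping.lookup f [] = 0"
      using f not_unital_principal_subalgebra[of K] by (auto simp: Id_alg_def)
    show "Poly_Mapping.lookup f w = Poly_Mapping.lookup 0 w"
    proof (cases "w = []")
      case False
      have "0 = Poly_Mapping.lookup (eval_poly ?A ?\<sigma> f) (v, concat (map u w))"
        using f carrier by (auto simp: Id_alg_def)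
      also have "\<dots> = (\<Sum>w'\<in>Poly_Mapping.keys f. Poly_Mapping.lookup f w' *
          (1 when concat (map u w') = concat (map u w)))"
        unfolding eval_poly_def lookup_sum A
      proof (rule sum.cong[OF refl])
        fix w' assume "w' \<in> Poly_Mapping.keys f"
        then have "w' \<noteq> []" using f0 by (auto simp: in_keys_iff)
        then show "Poly_Mapping.lookup (path_scale (Poly_Mapping.lookup f w') (eval_word ?A ?\<sigma> w'))
            (v, concat (map u w)) =
            Poly_Mapping.lookup f w' * (1 when concat (map u w') = concat (map u w))"
          by (simp add: word lookup_single)
      qed
      also have "\<dots> = (\<Sum>w'\<in>Poly_Mapping.keys f. if w' = w then Poly_Mapping.lookup f w' else 0)"
        using injD[OF inj_concat_map_code[OF cd(3-5), folded u_def]]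
        by (intro sum.cong refl) (auto simp: when_def)
      also have "\<dots> = Poly_Mapping.lookup f w"
        by (simp add: in_keys_iff)
      finally show ?thesis by simp
    qed (simp add: f0)
  qed
  moreover have "0 \<in> Id_alg ?A" by (simp add: Id_alg_def eval_poly_def)
  ultimately show ?thesis by blast
qed

section \<open>Constant terms and the inclusion between the two sets of identities\<close>

lemma lookup_Nil_Id_path_algebra:
  assumes "f \<in> Id_alg (path_algebra (K :: 'k::field itself) Q)"
  shows "Poly_Mapping.lookup f [] = 0"
proof -
  let ?A = "path_algebra K Q"
  interpret assoc_alg ?A by (rule assoc_alg_path_algebra)
  have A: "amult ?A = path_mult Q" "ascale ?A = path_scale"
    "acarrier ?A = {f. Poly_Mapping.keys f \<subseteq> qpaths Q}"
    by (simp_all add: path_algebra_def)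
  obtain e where e: "is_unit_elem ?A e" using unital_path_algebra[of K] by (auto simp: unital_def)
  obtain v where "v \<in> verts Q" using verts_nonempty by blast
  then have "Poly_Mapping.single (v, []) 1 \<in> acarrier ?A"
    by (auto simp: A qpaths_def awalk_Nil_iff)
  \<comment> \<open>The unit fixes a trivial path, so it is not zero and has a non-zero coefficient
    at some path \<open>p\<close>.\<close>
  then have "path_mult Q e (Poly_Mapping.single (v, []) 1) = Poly_Mapping.single (v, []) 1"
    using e by (auto simp: is_unit_elem_def A)
  moreover have "Poly_Mapping.single (v, []) (1::'k) \<noteq> 0" by (simp flip: keys_eq_empty)
  ultimately have "e \<noteq> 0" by (metis path_mult_zero(1))
  then obtain p where "p \<in> Poly_Mapping.keys e" by (metis all_not_in_conv keys_eq_empty)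
  then have p: "Poly_Mapping.lookup e p \<noteq> 0" by (simp add: in_keys_iff)
  \<comment> \<open>Under the zero substitution every non-empty word vanishes, and only the constant
    term times the unit remains. The case split follows the three equations of
    \<open>eval_word\<close>.\<close>
  have word: "eval_word ?A (\<lambda>_. 0) w = (if w = [] then e else 0)" for w
    using is_unit_elem_the[OF e] by (cases w rule: remdups_adj.cases) (auto simp: A)
  have "0 = Poly_Mapping.lookup (eval_poly ?A (\<lambda>_. 0) f) p"
    using assms by (auto simp: Id_alg_def A)
  also have "\<dots> = (\<Sum>w\<in>Poly_Mapping.keys f.
      if w = [] then Poly_Mapping.lookup f w * Poly_Mapping.lookup e p else 0)"
    unfolding eval_poly_def lookup_sum A
    by (intro sum.cong refl) (simp add: word)
  also have "\<dots> = Poly_Mapping.lookup f [] * Poly_Mapping.lookup e p"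
    by (simp add: in_keys_iff)
  finally show ?thesis using p by simp
qed

text \<open>Identities pass to a subalgebra. Since only the larger algebra has a unit, the constant
  term has to vanish for this.\<close>

lemma Id_path_algebra_subset:
  "Id_alg (path_algebra (K :: 'k::field itself) Q) \<subseteq> Id_alg (principal_subalgebra K Q)"
proof
  fix f assume f: "f \<in> Id_alg (path_algebra K Q)"
  show "f \<in> Id_alg (principal_subalgebra K Q)"
    unfolding Id_alg_def
  proof (intro CollectI conjI impI allI)
    fix \<sigma> :: "nat \<Rightarrow> _" assume "\<forall>i. \<sigma> i \<in> acarrier (principal_subalgebra K Q)"
    then have "\<forall>i. \<sigma> i \<in> acarrier (path_algebra K Q)"
      by (auto simp: path_algebra_def principal_subalgebra_def nontrivial_qpaths_def)
    moreover have "eval_poly (principal_subalgebra K Q) \<sigma> f = eval_poly (path_algebra K Q) \<sigma> f"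
      by (rule eval_poly_cong)
        (simp_all add: path_algebra_def principal_subalgebra_def lookup_Nil_Id_path_algebra[OF f])
    ultimately show "eval_poly (principal_subalgebra K Q) \<sigma> f = 0"
      using f by (simp add: Id_alg_def)
  qed (rule lookup_Nil_Id_path_algebra[OF f])
qed

lemma Id_path_algebra_branching:
  assumes "branching Q"
  shows "Id_alg (path_algebra (K :: 'k::field itself) Q) = {0}"
proof -
  have "0 \<in> Id_alg (path_algebra K Q)" by (simp add: Id_alg_def eval_poly_def)
  then show ?thesis
    using Id_path_algebra_subset[of K] Id_principal_subalgebra_branching[OF assms, of K] by blast
qed

subsection \<open>Acyclic quivers\<close>

text \<open>A repeated vertex would cut out a non-trivial closed subwalk; hence the vertices on the
  path are distinct.\<close>

lemma acyclic_length_less: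
  assumes "acyclic_quiver Q" "p \<in> qpaths Q"
  shows "length (snd p) < card (verts Q)"
proof -
  have w: "awalk (qstart p) (snd p) (qend Q p)" by (rule qpathsE[OF assms(2)])
  have "distinct (awalk_verts (qstart p) (snd p))"
  proof (rule ccontr)
    assume "\<not> ?thesis"
    then obtain r u where "r \<noteq> []" "awalk u r u"
      using awalk_not_distinct_decomp[OF w] by auto
    then have "(u, r) \<in> nontrivial_qpaths Q" "qstart (u, r) = qend Q (u, r)"
      using qpathsI[of u r u] by (simp_all add: nontrivial_qpaths_def)
    then show False
      using assms(1) unfolding acyclic_quiver_def by blast
  qed
  with w have "apath (qstart p) (snd p) (qend Q p)" by (simp add: apath_def)
  then show ?thesis by (rule length_apath_less)
qed

text \<open>The power of one variable whose exponent is the number of vertices separates the two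
  sets: on non-trivial paths the length bound kills it, while it maps a trivial path to
  itself.\<close>

lemma Id_acyclic_psubset:
  assumes "acyclic_quiver Q"
  shows "Id_alg (path_algebra (K :: 'k::field itself) Q) \<subset> Id_alg (principal_subalgebra K Q)"
proof -
  let ?P = "principal_subalgebra K Q" and ?A = "path_algebra K Q"
  define N where "N = card (verts Q)"
  have "N \<noteq> 0" using verts_nonempty by (simp add: N_def)
  define f :: "'k free_alg" where "f = Poly_Mapping.single (replicate N 0) 1"
  have f0: "Poly_Mapping.lookup f [] = 0" using \<open>N \<noteq> 0\<close> by (simp add: f_def lookup_single)
  have "f \<in> Id_alg ?P"
    unfolding Id_alg_def
  proof (intro CollectI conjI impI allI)
    fix \<sigma> :: "nat \<Rightarrow> _" assume \<sigma>: "\<forall>i. \<sigma> i \<in> acarrier ?P"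
    show "eval_poly ?P \<sigma> f = 0"
    proof (rule poly_mapping_eqI)
      fix r
      have "factorizations Q f (value_support f \<sigma>) snd r = {}"
      proof (rule equals0I)
        fix s assume "s \<in> factorizations Q f (value_support f \<sigma>) snd r"
        then have s: "set s \<subseteq> value_support f \<sigma>" "map fst s = replicate N 0"
          "composable Q (map snd s)"
          by (auto simp: factorizations_def f_def)
        have len: "length s = N" using arg_cong[OF s(2), of length] by simp
        have sub: "snd ` set s \<subseteq> nontrivial_qpaths Q"
          using s(1) \<sigma> by (fastforce simp: value_support_def principal_subalgebra_def)
        then have "concat_qpaths (map snd s) \<in> qpaths Q"
          using s len \<open>N \<noteq> 0\<close> by (intro concat_qpaths_in_qpaths) (auto simp: nontrivial_qpaths_def)
        \<comment> \<open>\<open>N\<close> non-trivial factors give a path with at least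
          \<open>N\<close> arrows, which exceeds the bound for acyclic quivers.\<close>
        from acyclic_length_less[OF assms this]
        have "(\<Sum>x\<leftarrow>s. length (snd (snd x))) < N"
          unfolding length_concat_qpaths N_def by (simp flip: sum_mset_sum_list)
        moreover have "(\<Sum>x\<leftarrow>s. 1) \<le> (\<Sum>x\<leftarrow>s. length (snd (snd x)))"
          using sub by (intro sum_list_mono) (fastforce simp: nontrivial_qpaths_def Suc_le_eq)
        ultimately show False using len by (simp add: sum_list_triv)
      qed
      then show "Poly_Mapping.lookup (eval_poly ?P \<sigma> f) r = Poly_Mapping.lookup 0 r"
        by (subst lookup_eval_poly_value_support[where Q = Q])
          (simp_all add: f0, simp_all add: principal_subalgebra_def)
    qed
  qed (use f0 in auto)
  moreover have "f \<notin> Id_alg ?A"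
  proof
    assume f: "f \<in> Id_alg ?A"
    obtain v where "v \<in> verts Q" using verts_nonempty by blast
    then have v: "awalk v [] v" by (simp add: awalk_Nil_iff)
    let ?e = "Poly_Mapping.single (v, []) (1::'k)"
    have "eval_word ?A (\<lambda>_. ?e) (replicate (Suc n) 0) = ?e" for n
    proof (induction n)
      case (Suc n)
      then show ?case
        using qpathsI[OF v] by (simp add: path_algebra_def path_mult_single qconcat_def)
    qed simp
    from this[of "N - 1"] have "eval_poly ?A (\<lambda>_. ?e) f = ?e"
      using \<open>N \<noteq> 0\<close> by (simp add: eval_poly_def f_def path_algebra_def path_scale_single)
    moreover have "eval_poly ?A (\<lambda>_. ?e) f = 0"
      using f qpathsI[OF v] by (auto simp: Id_alg_def path_algebra_def)
    ultimately show False by (metis lookup_single_eq lookup_zero zero_neq_one)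
  qed
  ultimately show ?thesis using Id_path_algebra_subset[of K] by blast
qed

subsection \<open>Quivers without branching\<close>

text \<open>If the walks leave \<open>u\<close> by different arrows \<open>a\<close> and
  \<open>b\<close>, each of them has to use the other arrow later and so to return to
  \<open>u\<close>. This yields closed walks at \<open>u\<close> beginning with \<open>a\<close> and
  with \<open>b\<close>, which is branching.\<close>

lemma awalk_eqI_mset:
  assumes "\<not> branching Q" "awalk u p v" "awalk u q w" "mset p = mset q"
  shows "p = q"
  using assms(2-)
proof (induction p arbitrary: u q)
  case (Cons a p)
  then obtain b q' where q: "q = b # q'" by (cases q) auto
  show ?case
  proof (cases "a = b")
    case True
    then show ?thesis using Cons q by (auto simp: awalk_Cons_iff)
  next
    case False
    \<comment> \<open>The walk is cut just before an occurrence of \<open>e'\<close>; what precedes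
      it is closed because \<open>e'\<close> leaves \<open>u\<close>.\<close>
    have loop: "\<exists>c. awalk u (e # c) u" if "awalk u (e # r) z" "e' \<in> set r" "tail Q e' = u" for e e' r z
    proof -
      obtain r1 r2 where "r = r1 @ e' # r2" using \<open>e' \<in> set r\<close> by (auto simp: in_set_conv_decomp)
      then have "awalk u ((e # r1) @ e' # r2) z" using that by simp
      then have "awalk u (e # r1) (tail Q e')"
        unfolding awalk_append_iff by (auto simp: awalk_Cons_iff)
      then show ?thesis using that by auto
    qed
    have "b \<in> set p" "a \<in> set q'"
      using Cons.prems(3) False q by (metis insert_iff list.simps(15) set_mset_mset)+
    moreover have "tail Q a = u" "tail Q b = u"
      using Cons.prems q by (auto simp: awalk_Cons_iff)
    ultimately obtain c d where "awalk u (a # c) u" "awalk u (b # d) u"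
      using loop Cons.prems q by metis
    then have "branching Q" unfolding branching_def using False by (metis list.sel(1) list.distinct(1))
    with assms(1) show ?thesis by contradiction
  qed
qed simp

text \<open>Rearranging the factors changes neither the multiset of arrows nor, by assumption, the
  starting vertex.\<close>

lemma concat_qpaths_eqI_mset:
  assumes "\<not> branching Q" "mset ps = mset qs" "ps \<noteq> []" "set ps \<subseteq> qpaths Q"
    and "composable Q ps" "composable Q qs" "qstart (hd ps) = qstart (hd qs)"
  shows "concat_qpaths ps = concat_qpaths qs"
proof -
  have "qs \<noteq> []" "set qs \<subseteq> qpaths Q"
    using assms(2-4) by (auto dest: mset_eq_setD)
  then have p: "concat_qpaths ps \<in> qpaths Q" and q: "concat_qpaths qs \<in> qpaths Q"
    using assms by (auto intro!: concat_qpaths_in_qpaths)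
  have start: "qstart (concat_qpaths ps) = qstart (concat_qpaths qs)" using assms by simp
  have "(\<Sum>p\<in>#mset ps. mset (snd p)) = (\<Sum>p\<in>#mset qs. mset (snd p))"
    using assms(2) by simp
  then have "mset (snd (concat_qpaths ps)) = mset (snd (concat_qpaths qs))"
    by (simp add: concat_qpaths_def mset_concat o_def flip: sum_mset_sum_list)
  with assms(1) qpathsE[OF p] qpathsE[OF q] have "snd (concat_qpaths ps) = snd (concat_qpaths qs)"
    unfolding start by (intro awalk_eqI_mset)
  with start show ?thesis by (simp add: prod_eq_iff qstart_def)
qed

text \<open>A non-zero identity is found among the multilinear polynomials in \<open>n\<close>
  variables. It suffices that the coefficients satisfy one linear equation for each choice of a
  starting vertex and of end points for the \<open>n\<close> substituted paths; for suitable
  \<open>n\<close> there are fewer equations than permutations.\<close>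

lemma Id_path_algebra_not_branching:
  assumes "\<not> branching Q"
  shows "Id_alg (path_algebra (K :: 'k::field itself) Q) \<noteq> {0}"
proof -
  let ?A = "path_algebra K Q"
  have A: "amult ?A = path_mult Q" "ascale ?A = path_scale"
    "acarrier ?A = {f. Poly_Mapping.keys f \<subseteq> qpaths Q}"
    by (simp_all add: path_algebra_def)
  let ?N = "card (verts Q)"
  \<comment> \<open>\<open>n > 0\<close> keeps the empty word out of \<open>J\<close>, so the
    polynomial has zero constant term.\<close>
  obtain n where n: "n > 0" "?N * (?N * ?N) ^ n < fact n"
    using fact_gt_exponential by blast
  \<comment> \<open>A pair \<open>(v, e)\<close> in \<open>I\<close> records the starting vertex of
    the product and, for each variable, the start and end of the path put in for it.
    \<open>J\<close> lists the multilinear monomials.\<close>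
  define I where "I = verts Q \<times> ({..<n} \<rightarrow>\<^sub>E verts Q \<times> verts Q)"
  define J where "J = permutations_of_set {..<n}"
  have J: "w \<noteq> []" "distinct w" "set w = {..<n}" if "w \<in> J" for w
  proof -
    show "distinct w" "set w = {..<n}"
      using permutations_of_setD[of w "{..<n}"] that by (simp_all add: J_def)
    then have "0 \<in> set w" using n(1) by simp
    then show "w \<noteq> []" by auto
  qed
  \<comment> \<open>\<open>adm (v, e) w\<close> means that factors with end points \<open>e\<close>,
    taken in the order \<open>w\<close>, compose to a path starting at \<open>v\<close>.\<close>
  define adm :: "'v \<times> (nat \<Rightarrow> 'v \<times> 'v) \<Rightarrow> nat list \<Rightarrow> bool" where
    "adm = (\<lambda>(v, e) w. successively (\<lambda>i j. snd (e i) = fst (e j)) w \<and> fst (e (hd w)) = v)"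
  have "finite J" by (simp add: J_def)
  have "finite I" unfolding I_def by (intro finite_cartesian_product finite_PiE) auto
  have "card I = ?N * (?N * ?N) ^ n" by (simp add: I_def card_cartesian_product card_PiE)
  then have "card I < card J" using n(2) by (simp add: J_def)
  have "\<exists>a :: nat list \<Rightarrow> 'k. (\<exists>w\<in>J. a w \<noteq> 0) \<and>
      (\<forall>i\<in>I. (\<Sum>w\<in>J. of_bool (adm i w) * a w) = 0)"
    by (rule underdetermined_system) fact+
  then obtain a :: "nat list \<Rightarrow> 'k" where a: "\<exists>w\<in>J. a w \<noteq> 0"
    "\<And>i. i \<in> I \<Longrightarrow> (\<Sum>w\<in>J. of_bool (adm i w) * a w) = 0"
    by blast
  define f where "f = (\<Sum>w\<in>J. Poly_Mapping.single w (a w))"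
  have lookup_f: "Poly_Mapping.lookup f w = (if w \<in> J then a w else 0)" for w
    using \<open>finite J\<close> by (simp add: f_def lookup_sum lookup_single when_def)
  have keys_f: "Poly_Mapping.keys f = {w \<in> J. a w \<noteq> 0}"
    by (auto simp: in_keys_iff lookup_f split: if_splits)
  have f0: "Poly_Mapping.lookup f [] = 0" using J[of "[]"] by (auto simp: lookup_f)
  have "f \<noteq> 0" using a(1) lookup_f by (metis lookup_zero)
  moreover have "f \<in> Id_alg ?A"
    unfolding Id_alg_def
  proof (intro CollectI conjI impI allI)
    fix \<sigma> :: "nat \<Rightarrow> _" assume \<sigma>: "\<forall>i. \<sigma> i \<in> acarrier ?A"
    define S where "S = value_support f \<sigma>"
    have S: "snd x \<in> qpaths Q" if "x \<in> S" for x
      using that \<sigma> unfolding S_def by (intro snd_value_support) (auto simp: A)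
    define c where "c = (\<lambda>x. Poly_Mapping.lookup (\<sigma> (fst x)) (snd x))"
    show "eval_poly ?A \<sigma> f = 0"
    proof (rule poly_mapping_eqI)
      fix r
      define F where "F = factorizations Q f S snd r"
      have "finite F" by (simp add: F_def S_def finite_factorizations finite_value_support)
      \<comment> \<open>The factorizations of \<open>r\<close> are grouped by their multiset, and
        each group contributes zero.\<close>
      have "(\<Sum>s | s \<in> F \<and> mset s = mset s0. Poly_Mapping.lookup f (map fst s) * (\<Prod>x\<leftarrow>s. c x)) = 0"
        if "s0 \<in> F" for s0
      proof -
        have s0: "set s0 \<subseteq> S" "map fst s0 \<in> J" "composable Q (map snd s0)"
          "concat_qpaths (map snd s0) = r" "s0 \<noteq> []"
          using that f0 by (auto simp: F_def factorizations_def keys_f in_keys_iff lookup_f)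
        \<comment> \<open>Every variable occurs once in \<open>s0\<close>, so a group fixes one path
          \<open>p i\<close> for each variable, and its members are recovered from their
          words.\<close>
        define p where "p i = the (map_of s0 i)" for i
        have p: "x = (fst x, p (fst x))" if "x \<in> set s0" for x
          using map_of_is_SomeI[OF J(2)[OF s0(2)], of "fst x" "snd x"] that
          by (simp add: p_def prod_eq_iff)
        have same: "map (\<lambda>i. (i, p i)) (map fst s) = s" if "set s = set s0" for s
          using p that by (auto intro: map_idI simp: o_def)
        have p_in: "p i \<in> qpaths Q" if "i < n" for i
        proof -
          have "i \<in> set (map fst s0)" using J[OF s0(2)] that by simp
          then obtain x where "x \<in> set s0" "fst x = i" by auto
          with p[of x] s0(1) S[of x] show ?thesis by (metis snd_conv subsetD)
        qed
        \<comment> \<open>\<open>restrict\<close> makes \<open>e\<close> a member of the extensional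
          function space in \<open>I\<close>.\<close>
        define e where "e = restrict (\<lambda>i. (qstart (p i), qend Q (p i))) {..<n}"
        have adm_iff: "adm (qstart r, e) w \<longleftrightarrow> composable Q (map p w) \<and> qstart (p (hd w)) = qstart r"
          if "w \<in> J" for w
        proof -
          have "hd w < n" using J[OF that] hd_in_set[of w] by auto
          moreover have "successively (\<lambda>i j. snd (e i) = fst (e j)) w \<longleftrightarrow>
              successively (\<lambda>i j. qend Q (p i) = qstart (p j)) w"
            using J[OF that] by (intro successively_cong) (auto simp: e_def)
          ultimately show ?thesis
            by (auto simp: adm_def composable_def successively_map e_def)
        qed
        let ?C = "{w \<in> J. a w \<noteq> 0 \<and> adm (qstart r, e) w}"
        \<comment> \<open>The group corresponds to the admissible words with non-zero coefficient.
          That such a word again multiplies to \<open>r\<close> is where the absence of branching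
          enters.\<close>
        have class_eq: "{s. s \<in> F \<and> mset s = mset s0} = map (\<lambda>i. (i, p i)) ` ?C"
        proof (intro equalityI subsetI)
          fix s assume "s \<in> {s. s \<in> F \<and> mset s = mset s0}"
          then have s: "s \<in> F" "set s = set s0" by (auto dest: mset_eq_setD)
          have w: "map fst s \<in> J" "a (map fst s) \<noteq> 0"
            using s(1) by (auto simp: F_def factorizations_def keys_f)
          have snd_s: "map p (map fst s) = map snd s"
            using arg_cong[OF same[OF s(2)], of "map snd"] by (simp add: o_def)
          have "adm (qstart r, e) (map fst s)"
            unfolding adm_iff[OF w(1)] snd_s
            using s(1) snd_s J[OF w(1)] by (auto simp: F_def factorizations_def hd_map simp flip: snd_s)
          then have "map fst s \<in> ?C" using w by simp
          then show "s \<in> map (\<lambda>i. (i, p i)) ` ?C" using same[OF s(2)] by (metis (no_types, lifting) image_eqI)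
        next
          fix s assume "s \<in> map (\<lambda>i. (i, p i)) ` ?C"
          then obtain w where w: "w \<in> J" "a w \<noteq> 0" "adm (qstart r, e) w"
            and s: "s = map (\<lambda>i. (i, p i)) w" by blast
          have "mset w = mset (map fst s0)"
            using J(2,3)[OF w(1)] J(2,3)[OF s0(2)]
            by (simp only: set_eq_iff_mset_eq_distinct[symmetric])
          then have "mset s = mset (map (\<lambda>i. (i, p i)) (map fst s0))"
            unfolding s mset_map[of "\<lambda>i. (i, p i)"] by simp
          then have ms: "mset s = mset s0" by (simp only: same[OF refl])
          have fst_s: "map fst s = w" and snd_s: "map snd s = map p w"
            by (simp_all add: s o_def)
          have "composable Q (map p w)" "qstart (p (hd w)) = qstart r"
            using w adm_iff by auto
          have "concat_qpaths (map snd s) = concat_qpaths (map snd s0)"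
          proof (rule concat_qpaths_eqI_mset[OF assms])
            show "mset (map snd s) = mset (map snd s0)" by (simp add: ms)
            show "map snd s \<noteq> []" unfolding snd_s using J(1)[OF w(1)] by simp
            show "set (map snd s) \<subseteq> qpaths Q"
              unfolding set_map mset_eq_setD[OF ms] using s0(1) S by blast
            show "composable Q (map snd s)" unfolding snd_s by fact
            show "composable Q (map snd s0)" by fact
            have "qstart (hd (map snd s0)) = qstart r" unfolding s0(4)[symmetric] by simp
            then show "qstart (hd (map snd s)) = qstart (hd (map snd s0))"
              unfolding snd_s hd_map[OF J(1)[OF w(1)]] using \<open>qstart (p (hd w)) = qstart r\<close> by simp
          qed
          then have "s \<in> F"
            unfolding F_def factorizations_def mem_Collect_eq
            using w(1,2) s0(1,4) mset_eq_setD[OF ms] \<open>composable Q (map p w)\<close>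
            by (simp add: fst_s snd_s[symmetric] keys_f)
          with ms show "s \<in> {s. s \<in> F \<and> mset s = mset s0}" by simp
        qed
        have inj: "inj_on (map (\<lambda>i. (i, p i))) ?C"
          by (rule inj_onI) (metis (no_types, lifting) fst_conv list.map_comp map_idI o_apply)
        \<comment> \<open>The scalar factor depends on the multiset only and can be taken out; what
          remains is the equation of the system for \<open>(qstart r, e)\<close>.\<close>
        have "(\<Sum>s | s \<in> F \<and> mset s = mset s0. Poly_Mapping.lookup f (map fst s) * (\<Prod>x\<leftarrow>s. c x))
          = (\<Sum>s | s \<in> F \<and> mset s = mset s0. Poly_Mapping.lookup f (map fst s) * (\<Prod>x\<leftarrow>s0. c x))"
        proof (rule sum.cong[OF refl])
          fix s assume "s \<in> {s. s \<in> F \<and> mset s = mset s0}"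
          then have "(\<Prod>x\<in>#mset s. c x) = (\<Prod>x\<in>#mset s0. c x)" by simp
          then show "Poly_Mapping.lookup f (map fst s) * (\<Prod>x\<leftarrow>s. c x) =
              Poly_Mapping.lookup f (map fst s) * (\<Prod>x\<leftarrow>s0. c x)"
            by (simp flip: prod_mset_prod_list)
        qed
        also have "\<dots> = (\<Sum>w\<in>?C. a w * (\<Prod>x\<leftarrow>s0. c x))"
          unfolding class_eq by (subst sum.reindex[OF inj]) (simp add: o_def lookup_f)
        also have "\<dots> = (\<Sum>w\<in>?C. a w) * (\<Prod>x\<leftarrow>s0. c x)"
          by (simp add: sum_distrib_right)
        also have "(\<Sum>w\<in>?C. a w) = (\<Sum>w\<in>J. of_bool (adm (qstart r, e) w) * a w)"
          by (rule sum.mono_neutral_cong_left) (use \<open>finite J\<close> in auto)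
        also have "\<dots> = 0"
        proof (rule a(2))
          have "set (map snd s0) \<subseteq> qpaths Q" unfolding set_map using s0(1) S by blast
          then have "r \<in> qpaths Q"
            unfolding s0(4)[symmetric] using s0(3,5) by (intro concat_qpaths_in_qpaths) simp_all
          then have "qstart r \<in> verts Q" using qpathsE by blast
          moreover have "qstart (p i) \<in> verts Q" "qend Q (p i) \<in> verts Q" if "i < n" for i
            using qpathsE[OF p_in[OF that]] by auto
          ultimately show "(qstart r, e) \<in> I" by (auto simp: I_def e_def)
        qed
        finally show ?thesis by simp
      qed
      then have "(\<Sum>M\<in>mset ` F. \<Sum>s | s \<in> F \<and> mset s = M.
          Poly_Mapping.lookup f (map fst s) * (\<Prod>x\<leftarrow>s. c x)) = 0"
        by (intro sum.neutral) auto
      then have "(\<Sum>s\<in>F. Poly_Mapping.lookup f (map fst s) * (\<Prod>x\<leftarrow>s. c x)) = 0"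
        using \<open>finite F\<close> by (subst (asm) sum.group) auto
      then show "Poly_Mapping.lookup (eval_poly ?A \<sigma> f) r = Poly_Mapping.lookup 0 r"
        by (subst lookup_eval_poly_value_support[OF A(1,2) f0]) (simp add: F_def S_def c_def)
    qed
  qed (use f0 in auto)
  ultimately show ?thesis by blast
qed

section \<open>Quivers without branching in which every vertex lies on a closed walk\<close>

text \<open>A coefficient of a value on the path algebra splits into sums over factorizations with
  equal multisets. Each of these sums is an entire coefficient of a value on the principal
  subalgebra, obtained by prolonging the substituted paths, and hence zero.\<close>

lemma Id_principal_subalgebra_subset:
  assumes "\<not> branching Q"
    and "\<forall>i\<in>verts Q. \<exists>p\<in>nontrivial_qpaths Q. qstart p = i \<and> qend Q p = i"
  shows "Id_alg (principal_subalgebra (K :: 'k::field itself) Q) \<subseteq> Id_alg (path_algebra K Q)"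
proof
  let ?A = "path_algebra K Q" and ?P = "principal_subalgebra K Q"
  have A: "amult ?A = path_mult Q" "ascale ?A = path_scale"
    "acarrier ?A = {f. Poly_Mapping.keys f \<subseteq> qpaths Q}"
    by (simp_all add: path_algebra_def)
  have P: "amult ?P = path_mult Q" "ascale ?P = path_scale"
    "acarrier ?P = {f. Poly_Mapping.keys f \<subseteq> nontrivial_qpaths Q}"
    by (simp_all add: principal_subalgebra_def)
  fix f assume f: "f \<in> Id_alg ?P"
  then have f0: "Poly_Mapping.lookup f [] = 0"
    using not_unital_principal_subalgebra[of K] by (auto simp: Id_alg_def)
  \<comment> \<open>Running \<open>n + 1\<close> times through a closed walk at the end point makes
    any path longer than \<open>n\<close>.\<close>
  have extend: "\<exists>q. (q \<in> qpaths Q \<and> qstart q = qstart p \<and> qend Q q = qend Q p) \<and> n < length (snd q)"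
    if p: "p \<in> qpaths Q" for p n
  proof -
    have w: "awalk (qstart p) (snd p) (qend Q p)" using p by (rule qpathsE)
    then have "qend Q p \<in> verts Q" by blast
    then obtain c where c: "c \<in> qpaths Q" "snd c \<noteq> []" "qstart c = qend Q p" "qend Q c = qend Q p"
      using assms(2) unfolding nontrivial_qpaths_def by blast
    have "awalk (qend Q p) (concat (replicate (Suc n) (snd c))) (qend Q p)"
      using qpathsE[OF c(1)] c by (intro awalk_replicate) simp
    then have "awalk (qstart p) (snd p @ concat (replicate (Suc n) (snd c))) (qend Q p)"
      by (rule awalk_appendI[OF w])
    moreover have "n < length (concat (replicate (Suc n) (snd c)))"
    proof -
      have "Suc n * 1 \<le> Suc n * length (snd c)"
        using c(2) by (intro mult_le_mono2) (simp add: Suc_le_eq)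
      then show ?thesis by (simp add: length_concat sum_list_replicate)
    qed
    ultimately show ?thesis
      using qpathsI[of "qstart p" "snd p @ concat (replicate (Suc n) (snd c))" "qend Q p"]
      by (intro exI[of _ "(qstart p, snd p @ concat (replicate (Suc n) (snd c)))"]) simp
  qed
  show "f \<in> Id_alg ?A"
    unfolding Id_alg_def
  proof (intro CollectI conjI impI allI)
    fix \<sigma> :: "nat \<Rightarrow> _" assume \<sigma>: "\<forall>i. \<sigma> i \<in> acarrier ?A"
    define S where "S = value_support f \<sigma>"
    have finS: "finite S" by (simp add: S_def finite_value_support)
    have S: "snd x \<in> qpaths Q" if "x \<in> S" for x
      using that \<sigma> unfolding S_def by (intro snd_value_support) (auto simp: A)
    define c where "c = (\<lambda>x. Poly_Mapping.lookup (\<sigma> (fst x)) (snd x))"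
    \<comment> \<open>\<open>d\<close> bounds the degree of \<open>f\<close>. For
      \<open>f = 0\<close> the maximum is unspecified, but then there is no word to bound.\<close>
    define d where "d = Max (length ` Poly_Mapping.keys f)"
    have d: "length s \<le> d" if "map fst s \<in> Poly_Mapping.keys f" for s :: "(nat \<times> ('v, 'a) qpath) list"
      unfolding d_def by (rule Max_ge, simp, rule image_eqI[OF _ that]) simp
    obtain q where q: "\<And>x. x \<in> S \<Longrightarrow> q x \<in> qpaths Q"
        "\<And>x. x \<in> S \<Longrightarrow> qstart (q x) = qstart (snd x)" "\<And>x. x \<in> S \<Longrightarrow> qend Q (q x) = qend Q (snd x)"
        "\<And>x. x \<in> S \<Longrightarrow> 0 < length (snd (q x))"
      and inj: "\<And>M N. set_mset M \<subseteq> S \<Longrightarrow> set_mset N \<subseteq> S \<Longrightarrow> size M \<le> d \<Longrightarrow> size N \<le> d \<Longrightarrow>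
       (\<Sum>x\<in>#M. length (snd (q x))) = (\<Sum>x\<in>#N. length (snd (q x))) \<Longrightarrow> M = N"
      using exists_fast_growing_choice[OF finS, where len = "\<lambda>y. length (snd y)" and d = d and
        P = "\<lambda>x y. y \<in> qpaths Q \<and> qstart y = qstart (snd x) \<and> qend Q y = qend Q (snd x)"]
        extend[OF S] by blast
    \<comment> \<open>\<open>\<tau>\<close> arises from \<open>\<sigma>\<close> by replacing the
      path of each summand \<open>x\<close> by \<open>q x\<close> and keeping its
      coefficient.\<close>
    define \<tau> where "\<tau> i = (\<Sum>x | x \<in> S \<and> fst x = i. Poly_Mapping.single (q x) (c x))" for i
    have "\<tau> i \<in> acarrier ?P" for i
    proof -
      have "Poly_Mapping.keys (\<tau> i) \<subseteq> (\<Union>x\<in>{x. x \<in> S \<and> fst x = i}. Poly_Mapping.keys (Poly_Mapping.single (q x) (c x)))"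
        unfolding \<tau>_def by (rule keys_sum)
      also have "\<dots> \<subseteq> nontrivial_qpaths Q"
        using q by (auto simp: nontrivial_qpaths_def)
      finally show ?thesis by (simp add: P)
    qed
    then have "eval_poly ?P \<tau> f = 0" using f by (auto simp: Id_alg_def)
    then have zero: "(\<Sum>s\<in>factorizations Q f S q r'. Poly_Mapping.lookup f (map fst s) * (\<Prod>x\<leftarrow>s. c x)) = 0"
      for r'
      using lookup_eval_poly[OF P(1,2) finS f0, of \<tau> q c r'] by (simp add: \<tau>_def)
    show "eval_poly ?A \<sigma> f = 0"
    proof (rule poly_mapping_eqI)
      fix r
      define F where "F = factorizations Q f S snd r"
      have "finite F" by (simp add: F_def finite_factorizations finS)
      have comp: "composable Q (map q s) \<longleftrightarrow> composable Q (map snd s)" if "set s \<subseteq> S" for s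
        using that q by (intro composable_cong) auto
      have start: "qstart (hd (map q s)) = qstart (hd (map snd s))" if "set s \<subseteq> S" "s \<noteq> []" for s
        using that q(2)[of "hd s"] by (simp add: hd_map subsetD)
      have "(\<Sum>s | s \<in> F \<and> mset s = mset s0. Poly_Mapping.lookup f (map fst s) * (\<Prod>x\<leftarrow>s. c x)) = 0"
        if "s0 \<in> F" for s0
      proof -
        have s0: "set s0 \<subseteq> S" "map fst s0 \<in> Poly_Mapping.keys f" "composable Q (map snd s0)"
          "concat_qpaths (map snd s0) = r" "s0 \<noteq> []"
          using that f0 by (auto simp: F_def factorizations_def in_keys_iff)
        \<comment> \<open>Without branching, equal multisets and starting vertices give equal
          products, both for the original and for the prolonged paths. Conversely, the length of a
          prolonged product determines the multiset.\<close>
        have "{s. s \<in> F \<and> mset s = mset s0} = factorizations Q f S q (concat_qpaths (map q s0))"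
        proof (intro equalityI subsetI)
          fix s assume s: "s \<in> {s. s \<in> F \<and> mset s = mset s0}"
          then have s': "set s \<subseteq> S" "map fst s \<in> Poly_Mapping.keys f" "composable Q (map snd s)"
            "concat_qpaths (map snd s) = r" "mset s = mset s0" "s \<noteq> []"
            using f0 by (auto simp: F_def factorizations_def in_keys_iff)
          have "qstart (hd (map snd s)) = qstart (hd (map snd s0))"
            using s'(4) s0(4) qstart_concat_qpaths by metis
          then have "concat_qpaths (map q s) = concat_qpaths (map q s0)"
            using s' s0 q comp start assms(1) by (intro concat_qpaths_eqI_mset) auto
          then show "s \<in> factorizations Q f S q (concat_qpaths (map q s0))"
            using s' comp by (simp add: factorizations_def)
        next
          fix s assume "s \<in> factorizations Q f S q (concat_qpaths (map q s0))"
          then have s: "set s \<subseteq> S" "map fst s \<in> Poly_Mapping.keys f" "composable Q (map snd s)"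
            "concat_qpaths (map q s) = concat_qpaths (map q s0)" "s \<noteq> []"
            using f0 comp by (auto simp: factorizations_def in_keys_iff)
          have "(\<Sum>x\<in>#mset s. length (snd (q x))) = (\<Sum>x\<in>#mset s0. length (snd (q x)))"
            using s(4) length_concat_qpaths by metis
          then have ms: "mset s = mset s0" using s s0 d by (intro inj) auto
          have "qstart (hd (map snd s)) = qstart (hd (map snd s0))"
            using s s0 start qstart_concat_qpaths by metis
          then have "concat_qpaths (map snd s) = concat_qpaths (map snd s0)"
            using s s0 S ms assms(1) by (intro concat_qpaths_eqI_mset) auto
          then show "s \<in> {s. s \<in> F \<and> mset s = mset s0}"
            using s s0 ms by (simp add: F_def factorizations_def)
        qed
        with zero show ?thesis by simp
      qed
      then have "(\<Sum>M\<in>mset ` F. \<Sum>s | s \<in> F \<and> mset s = M.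
          Poly_Mapping.lookup f (map fst s) * (\<Prod>x\<leftarrow>s. c x)) = 0"
        by (intro sum.neutral) auto
      then have "(\<Sum>s\<in>F. Poly_Mapping.lookup f (map fst s) * (\<Prod>x\<leftarrow>s. c x)) = 0"
        using \<open>finite F\<close> by (subst (asm) sum.group) auto
      then show "Poly_Mapping.lookup (eval_poly ?A \<sigma> f) r = Poly_Mapping.lookup 0 r"
        by (subst lookup_eval_poly_value_support[OF A(1,2) f0]) (simp add: F_def S_def c_def)
    qed
  qed (use f0 in auto)
qed

end

theorem theorem1p3:
  fixes K :: "'k::field_char_0 itself"
    and Q :: "('v, 'a) pre_digraph"
  assumes "finite_quiver Q"
  shows "(\<not> PI_quiver K Q \<longrightarrow>
            Id_alg (path_algebra K Q) = Id_alg (principal_subalgebra K Q) \<and>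
            Id_alg (principal_subalgebra K Q) = {0})
       \<and> (acyclic_quiver Q \<longrightarrow>
            Id_alg (path_algebra K Q) \<subset> Id_alg (principal_subalgebra K Q))
       \<and> (PI_quiver K Q \<and> \<not> acyclic_quiver Q \<and>
          (\<forall>i\<in>verts Q. \<exists>p\<in>nontrivial_qpaths Q. qstart p = i \<and> qend Q p = i) \<longrightarrow>
            Id_alg (path_algebra K Q) = Id_alg (principal_subalgebra K Q))"
proof -
  interpret finite_quiver Q by (rule assms)
  \<comment> \<open>A branching quiver has only the zero identity and any other quiver has a
    non-zero one, so the hypotheses on \<open>PI\<close> become statements about branching.\<close>
  have PI: "PI_quiver K Q \<longleftrightarrow> \<not> branching Q"
    unfolding PI_quiver_def PI_alg_def
    using Id_path_algebra_branching Id_path_algebra_not_branching by blast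
  show ?thesis
    unfolding PI
    using Id_path_algebra_branching[of K] Id_principal_subalgebra_branching[of K]
      Id_acyclic_psubset[of K] Id_path_algebra_subset[of K] Id_principal_subalgebra_subset[of K]
    by (intro conjI impI equalityI) auto
qed

end
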